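(* Let $d\ge2$. Suppose that there is $c_2>0$ such that $\sup_{x,y\in\mathbb R^d}p_t(x,y)\le c_2t^{-d/2}$ for all $t\in(0,1]$, and that $\mathbf X$ is exponentially $\beta$-mixing, i.e. there are constants $c_\kappa,\kappa>0$ with $$\int_{\mathbb R^d}\|P_t(x,\cdot)-\mu\|_{\mathrm{TV}}\,\mu(dx)\le c_\kappa e^{-\kappa t},\qquad t\ge0.$$ Let $f:\mathbb R^d\to\mathbb R$ be a bounded measurable function with compact support $\mathcal S$ fulfilling $\boldsymbol\lambda(\mathcal S)<1$. Then there exists a constant $C>0$ not depending on $f$ such that, for any $T>0$, $$\mathrm{Var}\Big(\int_0^Tf(X_t)\,dt\Big)\le C\,T\,\|f\|_\infty^2\,\|\rho\|_\infty\,\boldsymbol\lambda^2(\mathcal S)\,\psi_d^2(\boldsymbol\lambda(\mathcal S)),$$ where $\psi_2(x)=\sqrt{1+\log(1/x)}$ and $\psi_d(x)=x^{\frac1d-\frac12}$ for $d\ge3$, and the variance is taken with respect to $\mathbb P^\mu$.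
   Context: $\mathbf X=(X_t)_{t\ge 0}$ with laws $(\mathbb P^x)_{x\in\mathbb R^d}$ is a non-explosive Borel right Markov process with state space $(\mathbb R^d,\mathcal B(\mathbb R^d))$ and semigroup $P_t(x,B)=\mathbb P^x(X_t\in B)$. Standing assumption: for any $t>0$, $x\in\mathbb R^d$ there is a measurable transition density $p_t:\mathbb R^d\times\mathbb R^d\to\mathbb R_+$ with $P_t(x,B)=\int_B p_t(x,y)\,dy$ for all Borel $B$, and $\mathbf X$ admits a unique invariant probability measure $\mu$, which is absolutely continuous with density $\rho:\mathbb R^d\to\mathbb R_+$. Under the bound on $p_t$ in the claim, $\mu$ has a bounded density, and $\rho$ denotes such a bounded version. $\mathbb P^\mu$ is the law of $\mathbf X$ with $X_0\sim\mu$; $\boldsymbol\lambda$ is Lebesgue measure on $\mathbb R^d$; $\|\nu\|_{\mathrm{TV}}=\sup_{|f|\le1}|\nu(f)|$ for a signed measure $\nu$. *)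

theory Defs
  imports "HOL-Probability.Probability"
begin

text \<open>
  A process is given by its coordinates \<open>X t\<close> on a measurable space \<open>M\<close> (only the values at
  times \<open>t \<ge> 0\<close> matter) and by the family \<open>Pr x\<close> of its laws, indexed by the starting point.
\<close>

definition transition ::
    "(real \<Rightarrow> 'w \<Rightarrow> 'a) \<Rightarrow> ('a \<Rightarrow> 'w measure) \<Rightarrow> real \<Rightarrow> 'a \<Rightarrow> 'a::topological_space measure" where
  "transition X Pr t x = distr (Pr x) borel (X t)"

text \<open>
  Filtrations are indexed by \<open>[0, \<infinity>]\<close> so that the library's stopping times may take the value
  \<open>\<infinity>\<close>; the entry at \<open>\<infinity>\<close> is generated by the whole process.
\<close>

definition history ::
    "'w measure \<Rightarrow> (real \<Rightarrow> 'w \<Rightarrow> 'a::topological_space) \<Rightarrow> ennreal \<Rightarrow> 'w measure" where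
  "history M X u = sigma (space M)
     {X s -` B \<inter> space M | s B. 0 \<le> s \<and> ennreal s \<le> u \<and> B \<in> sets borel}"

definition right_history ::
    "'w measure \<Rightarrow> (real \<Rightarrow> 'w \<Rightarrow> 'a::topological_space) \<Rightarrow> ennreal \<Rightarrow> 'w measure" where
  "right_history M X u = sigma (space M) (\<Inter>v\<in>{v. u < v \<or> v = \<infinity>}. sets (history M X v))"

lemma space_history [simp]: "space (history M X u) = space M"
  unfolding history_def by (rule space_measure_of) auto

lemma filtration_right_history: "filtration (space M) (right_history M X)"
proof
  have sub: "(\<Inter>v\<in>{v. u < v \<or> v = \<infinity>}. sets (history M X v)) \<subseteq> Pow (space M)" for u
    using sets.sets_into_space[of _ "history M X \<infinity>"] by auto
  show "space (right_history M X u) = space M" for u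
    unfolding right_history_def by (rule space_measure_of) (rule sub)
  show "sets (right_history M X u) \<le> sets (right_history M X v)" if "u \<le> v" for u v
    unfolding right_history_def sets_measure_of[OF sub] using that
    by (intro sigma_sets_mono') force
qed

text \<open>
  A non-explosive Borel right process: a normal, right-continuous strong Markov process with Borel
  measurable transition kernels. Non-explosiveness is the absence of a cemetery state: paths stay
  in the state space at all times and the \<open>Pr x\<close> are probability measures. The strong Markov
  property is taken with respect to the right-continuous natural filtration. It is equivalent to
  state it for the usual augmentation, since every stopping time of the filtration augmented under
  a given initial law is almost surely equal to one of the filtration used here.
\<close>

locale borel_right_process =
  fixes M :: "'w measure"
    and X :: "real \<Rightarrow> 'w \<Rightarrow> 'a::polish_space"
    and Pr :: "'a \<Rightarrow> 'w measure"
  assumes measurable_X: "\<And>t. 0 \<le> t \<Longrightarrow> X t \<in> M \<rightarrow>\<^sub>M borel"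
    and kernel: "Pr \<in> borel \<rightarrow>\<^sub>M prob_algebra M"
    and normal: "\<And>x. AE \<omega> in Pr x. X 0 \<omega> = x"
    and right_continuous:
      "\<And>\<omega> t. \<omega> \<in> space M \<Longrightarrow> 0 \<le> t \<Longrightarrow> continuous (at_right t) (\<lambda>s. X s \<omega>)"
    and strong_markov:
      "\<And>x \<tau> A t B. stopping_time (right_history M X) \<tau> \<Longrightarrow>
         A \<in> sets (filtration.pre_sigma (space M) (right_history M X) \<tau>) \<Longrightarrow>
         0 \<le> t \<Longrightarrow> B \<in> sets borel \<Longrightarrow>
         emeasure (Pr x) {\<omega>\<in>A. \<tau> \<omega> < \<infinity> \<and> X (enn2real (\<tau> \<omega>) + t) \<omega> \<in> B} =
         (\<integral>\<^sup>+\<omega>\<in>{\<omega>\<in>A. \<tau> \<omega> < \<infinity>}. emeasure (transition X Pr t (X (enn2real (\<tau> \<omega>)) \<omega>)) B \<partial>Pr x)"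

definition invariant_prob :: "(real \<Rightarrow> 'a \<Rightarrow> 'a measure) \<Rightarrow> 'a::topological_space measure \<Rightarrow> bool" where
  "invariant_prob P \<mu> \<longleftrightarrow>
     prob_space \<mu> \<and> sets \<mu> = sets borel \<and>
     (\<forall>t\<ge>0. \<forall>B\<in>sets borel. (\<integral>\<^sup>+x. emeasure (P t x) B \<partial>\<mu>) = emeasure \<mu> B)"

text \<open>The total variation norm of the signed measure \<open>P - Q\<close>, for probability measures \<open>P\<close>, \<open>Q\<close>.\<close>

definition tv_norm_diff :: "'a::topological_space measure \<Rightarrow> 'a measure \<Rightarrow> real" where
  "tv_norm_diff P Q =
     (SUP g\<in>{g \<in> borel_measurable borel. \<forall>x. \<bar>g x\<bar> \<le> (1::real)}. \<bar>(\<integral>x. g x \<partial>P) - (\<integral>x. g x \<partial>Q)\<bar>)"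

definition exp_beta_mixing :: "(real \<Rightarrow> 'a \<Rightarrow> 'a measure) \<Rightarrow> 'a::topological_space measure \<Rightarrow> bool" where
  "exp_beta_mixing P \<mu> \<longleftrightarrow>
     (\<exists>c>0. \<exists>\<kappa>>0. \<forall>t\<ge>0.
        (\<integral>\<^sup>+x. ennreal (tv_norm_diff (P t x) \<mu>) \<partial>\<mu>) \<le> ennreal (c * exp (- \<kappa> * t)))"

definition supp :: "('a::topological_space \<Rightarrow> real) \<Rightarrow> 'a set" where
  "supp f = closure {x. f x \<noteq> 0}"

definition sup_norm :: "('a \<Rightarrow> real) \<Rightarrow> real" where
  "sup_norm f = (SUP x. \<bar>f x\<bar>)"

text \<open>
  Only used for \<open>d \<ge> 2\<close>. The value at \<open>x = 0\<close> is irrelevant: below it is multiplied by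
  \<open>x\<^sup>2 = 0\<close>, which is also the limit of \<open>x\<^sup>2 (psi d x)\<^sup>2\<close> as \<open>x\<close> tends to \<open>0\<close>.
\<close>

definition psi :: "nat \<Rightarrow> real \<Rightarrow> real" where
  "psi d x = (if d = 2 then sqrt (1 + ln (1 / x)) else x powr (1 / real d - 1 / 2))"

end

theory Submission
  imports Defs
begin

text \<open>
  Write \<open>b\<close> and \<open>R\<close> for the sup norms of \<open>f\<close> and \<open>\<rho>\<close>, \<open>l\<close> for the volume of the support \<open>S\<close>, and \<open>K(u)\<close>
  for the covariance of \<open>f(X\<^sub>s)\<close> and \<open>f(X\<^bsub>s+u\<^esub>)\<close> under the stationary law, which is the same for all \<open>s\<close>.
  By Fubini the variance of \<open>\<integral>\<^sub>0\<^sup>T f(X\<^sub>t) dt\<close> is the integral of \<open>K(\<bar>t - s\<bar>)\<close> over \<open>[0, T]\<^sup>2\<close>, so it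
  is at most \<open>2 T \<integral>\<^sub>0\<^sup>\<infinity> \<bar>K(u)\<bar> du\<close> (\<open>second_moment_time_integral_le\<close>, \<open>variance_time_integral_le\<close>).
  It remains to bound this integral by a multiple of \<open>b\<^sup>2 R l\<^sup>2 (psi d l)\<^sup>2\<close>.

  Two estimates of \<open>K(u)\<close> compete. If \<open>P\<^sub>u(x, S) \<le> q\<close> for all \<open>x\<close>, then the Markov property and
  \<open>\<mu>(S) \<le> R l\<close> give \<open>\<bar>K(u)\<bar> \<le> b\<^sup>2 R l (q + R l)\<close> (\<open>covariance_le_return_probability\<close>). The density
  bound allows \<open>q = c2 u powr (- d / 2) l\<close> for \<open>u \<le> 1\<close>, and Chapman--Kolmogorov allows \<open>q = c2 l\<close> for all
  \<open>u \<ge> 1\<close>; the trivial \<open>q = 1\<close> is better for very small \<open>u\<close>. On the other hand, mixing gives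
  \<open>\<bar>K(u)\<bar> \<le> 2 b\<^sup>2 c exp (- \<kappa> u)\<close> (\<open>covariance_le_mixing\<close>), which decays in \<open>u\<close> but does not see the
  smallness of \<open>S\<close>.

  The trivial bound is integrated up to \<open>\<delta> = l powr (2 / d)\<close> (\<open>dimension_scale\<close>), the density bounds
  from there up to \<open>\<tau> = 1 + (2 / \<kappa>) ln (1 / l)\<close>, and the mixing bound beyond. The range below \<open>1\<close>
  produces \<open>l\<^sup>2 (psi d l)\<^sup>2\<close>, with the logarithm for \<open>d = 2\<close> coming from \<open>\<integral>\<^sub>\<delta>\<^sup>1 du / u\<close>. The range from \<open>1\<close> to
  \<open>\<tau>\<close> produces \<open>l\<^sup>2 ln (1 / l)\<close>, and the tail beyond \<open>\<tau>\<close> produces \<open>l\<^sup>2\<close> by the choice of \<open>\<tau>\<close>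
  (\<open>time_scales_sum_le\<close>). Both are dominated by \<open>l\<^sup>2 (psi d l)\<^sup>2\<close> up to constants depending
  on \<open>R\<close>, \<open>c2\<close>, \<open>c\<close> and \<open>\<kappa>\<close>. If \<open>l = 0\<close>, every
  \<open>K(u)\<close> vanishes.
\<close>

section \<open>Time integrals of measurable processes\<close>

text \<open>
  Right continuity makes \<open>Y t\<close> the limit of \<open>Y\<close> evaluated at grid points of mesh \<open>1 / (n + 1)\<close> strictly to the
  right of \<open>t\<close>. Each approximation takes countably many time values and is therefore jointly
  measurable, and joint measurability passes to the limit.
\<close>

lemma right_continuous_process_measurable:
  fixes Y :: "real \<Rightarrow> 'w \<Rightarrow> 'a::metric_space"
  assumes Y: "\<And>t. Y t \<in> M \<rightarrow>\<^sub>M borel"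
    and cont: "\<And>\<omega> t. \<omega> \<in> space M \<Longrightarrow> continuous (at_right t) (\<lambda>s. Y s \<omega>)"
  shows "(\<lambda>(t, \<omega>). Y t \<omega>) \<in> borel \<Otimes>\<^sub>M M \<rightarrow>\<^sub>M borel"
proof -
  define r where "r n t = (of_int (\<lfloor>real (Suc n) * t\<rfloor> + 1) / real (Suc n) :: real)" for n t
  have "r n t > t \<and> r n t \<le> t + 1 / real (Suc n)" for n t
  proof -
    have "real (Suc n) * t < of_int (\<lfloor>real (Suc n) * t\<rfloor> + 1)"
      "of_int (\<lfloor>real (Suc n) * t\<rfloor> + 1) \<le> real (Suc n) * t + 1"
      by linarith+
    then show ?thesis
      by (simp add: r_def field_simps del: of_nat_Suc)
  qed
  note r = this[THEN conjunct1] this[THEN conjunct2]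
  have r_lim: "filterlim (\<lambda>n. r n t) (at_right t) sequentially" for t
  proof -
    have "(\<lambda>n. t + 1 / real (Suc n)) \<longlonglongrightarrow> t"
      using tendsto_add[OF tendsto_const[of t] LIMSEQ_inverse_real_of_nat]
      by (simp add: inverse_eq_divide)
    then have "(\<lambda>n. r n t) \<longlonglongrightarrow> t"
      by (rule tendsto_sandwich[OF _ _ tendsto_const, rotated 2])
         (use r in \<open>auto intro!: always_eventually less_imp_le\<close>)
    then show ?thesis
      using r(1)[of t] by (simp add: filterlim_at less_imp_neq[symmetric])
  qed
  show ?thesis
  proof (rule borel_measurable_LIMSEQ_metric)
    fix n
    have floor: "(\<lambda>t. \<lfloor>real (Suc n) * t\<rfloor>) \<in> borel \<rightarrow>\<^sub>M count_space UNIV"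
      by measurable
    have "(\<lambda>z. Y (of_int (k + 1) / real (Suc n)) (snd z)) \<in> borel \<Otimes>\<^sub>M M \<rightarrow>\<^sub>M borel" for k
      by (rule measurable_compose[OF measurable_snd Y])
    then have "(\<lambda>z. Y (of_int (\<lfloor>real (Suc n) * fst z\<rfloor> + 1) / real (Suc n)) (snd z)) \<in> borel \<Otimes>\<^sub>M M \<rightarrow>\<^sub>M borel"
      by (rule measurable_compose_countable[where f="\<lambda>k z. Y (of_int (k + 1) / real (Suc n)) (snd z)"])
         (rule measurable_compose[OF measurable_fst floor])
    then show "(\<lambda>(t, \<omega>). Y (r n t) \<omega>) \<in> borel \<Otimes>\<^sub>M M \<rightarrow>\<^sub>M borel"
      unfolding r_def by (simp add: case_prod_beta)
  next
    fix z :: "real \<times> 'w" assume "z \<in> space (borel \<Otimes>\<^sub>M M)"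
    then have "continuous (at_right (fst z)) (\<lambda>s. Y s (snd z))"
      by (intro cont) (auto simp: space_pair_measure)
    then have "((\<lambda>s. Y s (snd z)) \<longlongrightarrow> Y (fst z) (snd z)) (at_right (fst z))"
      by (simp add: continuous_within)
    from filterlim_compose[OF this r_lim]
    show "(\<lambda>n. case z of (t, \<omega>) \<Rightarrow> Y (r n t) \<omega>) \<longlonglongrightarrow> (case z of (t, \<omega>) \<Rightarrow> Y t \<omega>)"
      by (simp add: case_prod_beta)
  qed
qed

text \<open>
  By Fubini, the second moment of \<open>\<integral>\<^sub>0\<^sup>T Z\<^sub>t dt\<close> is the integral of \<open>E(Z\<^sub>s Z\<^sub>t)\<close> over the
  square \<open>[0, T]\<^sup>2\<close>. For fixed \<open>s\<close> the inner integral sees the lag \<open>\<bar>t - s\<bar>\<close> at most twice, once on each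
  side of \<open>s\<close>, so it is at most \<open>2 H\<close>. The diagonal is a null set, which is why the bound \<open>D\<close> only has
  to hold for positive lags and may blow up at zero.
\<close>

lemma (in prob_space) second_moment_time_integral_le:
  fixes Z :: "real \<Rightarrow> 'a \<Rightarrow> real" and D :: "real \<Rightarrow> real"
  assumes T: "0 \<le> T"
    and Z [measurable]: "(\<lambda>(t, \<omega>). Z t \<omega>) \<in> borel_measurable (borel \<Otimes>\<^sub>M M)"
    and bound: "\<And>t \<omega>. \<omega> \<in> space M \<Longrightarrow> \<bar>Z t \<omega>\<bar> \<le> b"
    and cov: "\<And>s u. 0 \<le> s \<Longrightarrow> 0 < u \<Longrightarrow> \<bar>expectation (\<lambda>\<omega>. Z s \<omega> * Z (s + u) \<omega>)\<bar> \<le> D u"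
    and D [measurable]: "D \<in> borel_measurable borel"
    and H: "(\<integral>\<^sup>+u. ennreal (D u) * indicator {0<..} u \<partial>lborel) \<le> ennreal H" "0 \<le> H"
  shows "expectation (\<lambda>\<omega>. (LBINT t:{0..T}. Z t \<omega>)\<^sup>2) \<le> 2 * T * H"
proof -
  define I where "I = restrict_space (lborel :: real measure) {0..T}"
  have space_I: "space I = {0..T}"
    by (simp add: I_def)
  have emeasure_I: "emeasure I (space I) = ennreal T"
    using T by (simp add: I_def emeasure_restrict_space)
  interpret I: finite_measure I
    by (rule finite_measureI) (simp add: emeasure_I)
  interpret II: pair_sigma_finite I I ..
  interpret II: finite_measure "I \<Otimes>\<^sub>M I"
    by (rule finite_measureI)
       (simp add: space_pair_measure I.emeasure_pair_measure_Times emeasure_I ennreal_mult_eq_top_iff)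
  interpret IIM: pair_sigma_finite "I \<Otimes>\<^sub>M I" M ..
  interpret IIM': finite_measure "(I \<Otimes>\<^sub>M I) \<Otimes>\<^sub>M M"
    by (rule finite_measureI)
       (use II.emeasure_finite in \<open>simp add: space_pair_measure[of "I \<Otimes>\<^sub>M I" M] emeasure_pair_measure_Times emeasure_space_1\<close>)
  have id_I [measurable]: "(\<lambda>t. t) \<in> I \<rightarrow>\<^sub>M borel"
    unfolding I_def by (rule measurable_restrict_space1) simp
  have b: "0 \<le> b"
    using bound not_empty by fastforce
  have ZZ: "\<bar>Z s \<omega> * Z t \<omega>\<bar> \<le> b * b" if "\<omega> \<in> space M" for s t \<omega>
    unfolding abs_mult by (intro mult_mono bound that) (use b in auto)
  have Zt [measurable]: "Z t \<in> borel_measurable M" for t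
    using measurable_compose[OF measurable_Pair1' Z] by simp
  have meas_ZZ [measurable]: "(\<lambda>((s, t), \<omega>). Z s \<omega> * Z t \<omega>) \<in> borel_measurable ((I \<Otimes>\<^sub>M I) \<Otimes>\<^sub>M M)"
  proof -
    have "(\<lambda>w. (fst (fst w), snd w)) \<in> (I \<Otimes>\<^sub>M I) \<Otimes>\<^sub>M M \<rightarrow>\<^sub>M borel \<Otimes>\<^sub>M M"
      "(\<lambda>w. (snd (fst w), snd w)) \<in> (I \<Otimes>\<^sub>M I) \<Otimes>\<^sub>M M \<rightarrow>\<^sub>M borel \<Otimes>\<^sub>M M"
      by measurable
    from borel_measurable_times[OF measurable_compose[OF this(1) Z] measurable_compose[OF this(2) Z]]
    show ?thesis by (simp add: split_beta')
  qed
  have int_ZZ: "integrable ((I \<Otimes>\<^sub>M I) \<Otimes>\<^sub>M M) (\<lambda>((s, t), \<omega>). Z s \<omega> * Z t \<omega>)"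
    by (rule IIM'.integrable_const_bound[where B="b * b", OF _ meas_ZZ])
       (auto intro!: AE_I2 ZZ simp: space_pair_measure)
  have sq: "(LBINT t:{0..T}. Z t \<omega>)\<^sup>2 = (\<integral>(s, t). Z s \<omega> * Z t \<omega> \<partial>(I \<Otimes>\<^sub>M I))"
    if \<omega>: "\<omega> \<in> space M" for \<omega>
  proof -
    have meas [measurable]: "(\<lambda>t. Z t \<omega>) \<in> borel_measurable I"
    proof -
      have "(\<lambda>t. (t, \<omega>)) \<in> I \<rightarrow>\<^sub>M borel \<Otimes>\<^sub>M M"
        using \<omega> by measurable
      from measurable_compose[OF this Z] show ?thesis by simp
    qed
    have "(LBINT t:{0..T}. Z t \<omega>) = (\<integral>t. Z t \<omega> \<partial>I)"
      unfolding I_def set_lebesgue_integral_def by (simp add: integral_restrict_space)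
    moreover have "(\<integral>t. Z t \<omega> \<partial>I) * (\<integral>t. Z t \<omega> \<partial>I) = (\<integral>s. (\<integral>t. Z s \<omega> * Z t \<omega> \<partial>I) \<partial>I)"
      by simp
    moreover have "integrable (I \<Otimes>\<^sub>M I) (\<lambda>(s, t). Z s \<omega> * Z t \<omega>)"
    proof (rule II.integrable_const_bound[where B="b * b"])
      show "AE z in I \<Otimes>\<^sub>M I. norm (case z of (s, t) \<Rightarrow> Z s \<omega> * Z t \<omega>) \<le> b * b"
        using ZZ[OF \<omega>] by (auto intro!: AE_I2)
    qed measurable
    ultimately show ?thesis
      by (simp add: II.integral_fst'[symmetric] power2_eq_square case_prod_beta)
  qed
  have inner: "(\<integral>\<^sup>+t. ennreal \<bar>expectation (\<lambda>\<omega>. Z s \<omega> * Z t \<omega>)\<bar> \<partial>I) \<le> ennreal (2 * H)"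
    if s: "s \<in> {0..T}" for s
  proof -
    define D' where "D' u = ennreal (D u) * indicator {0<..} u" for u
    have D': "D' \<in> borel_measurable borel"
      using D unfolding D'_def by measurable
    have D'_shift: "(\<lambda>t. D' (- s + 1 * t)) \<in> borel_measurable lborel"
      "(\<lambda>t. D' (s + - 1 * t)) \<in> borel_measurable lborel"
      by (rule measurable_compose[OF _ D'], simp)+
    have "(\<integral>\<^sup>+t. ennreal \<bar>expectation (\<lambda>\<omega>. Z s \<omega> * Z t \<omega>)\<bar> \<partial>I) =
      (\<integral>\<^sup>+t. ennreal \<bar>expectation (\<lambda>\<omega>. Z s \<omega> * Z t \<omega>)\<bar> * indicator {0..T} t \<partial>lborel)"
      by (simp add: I_def nn_integral_restrict_space)
    \<comment> \<open>The affine arguments are written as \<open>t\<^sub>0 + c t\<close> so that the substitution rule applies verbatim.\<close>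
    also have "\<dots> \<le> (\<integral>\<^sup>+t. D' (- s + 1 * t) + D' (s + - 1 * t) \<partial>lborel)"
    proof (intro nn_integral_mono_AE)
      have "AE t in lborel. t \<noteq> s"
        by (rule AE_lborel_singleton)
      then show "AE t in lborel. ennreal \<bar>expectation (\<lambda>\<omega>. Z s \<omega> * Z t \<omega>)\<bar> * indicator {0..T} t
          \<le> D' (- s + 1 * t) + D' (s + - 1 * t)"
      proof eventually_elim
        case (elim t)
        then consider "s < t" | "t < s" by linarith
        then show ?case
        proof cases
          case 1
          then show ?thesis
            using cov[of s "t - s"] s by (auto simp: D'_def split: split_indicator intro!: ennreal_leI)
        next
          case 2
          then show ?thesis
            using cov[of t "s - t"] s
            by (auto split: split_indicator intro!: ennreal_leI simp: D'_def mult.commute)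
        qed
      qed
    qed
    also have "\<dots> = (\<integral>\<^sup>+t. D' (- s + 1 * t) \<partial>lborel) + (\<integral>\<^sup>+t. D' (s + - 1 * t) \<partial>lborel)"
      by (rule nn_integral_add) (fact D'_shift)+
    also have "(\<integral>\<^sup>+t. D' (- s + 1 * t) \<partial>lborel) = (\<integral>\<^sup>+u. D' u \<partial>lborel)"
      using nn_integral_real_affine[OF D', of 1 "- s"] by simp
    also have "(\<integral>\<^sup>+t. D' (s + - 1 * t) \<partial>lborel) = (\<integral>\<^sup>+u. D' u \<partial>lborel)"
      using nn_integral_real_affine[OF D', of "- 1" s] by simp
    also have "(\<integral>\<^sup>+u. D' u \<partial>lborel) + (\<integral>\<^sup>+u. D' u \<partial>lborel) \<le> ennreal H + ennreal H"
      using H(1) unfolding D'_def by (intro add_mono)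
    also have "\<dots> = ennreal (2 * H)"
      using H(2) by (simp flip: ennreal_plus)
    finally show ?thesis .
  qed
  have E_meas [measurable]: "(\<lambda>(s, t). expectation (\<lambda>\<omega>. Z s \<omega> * Z t \<omega>)) \<in> borel_measurable (I \<Otimes>\<^sub>M I)"
    using borel_measurable_lebesgue_integral[where f="\<lambda>(s, t) \<omega>. Z s \<omega> * Z t \<omega>" and N="I \<Otimes>\<^sub>M I"] meas_ZZ
    by (simp add: split_beta')
  have "expectation (\<lambda>\<omega>. (LBINT t:{0..T}. Z t \<omega>)\<^sup>2) =
      expectation (\<lambda>\<omega>. \<integral>(s, t). Z s \<omega> * Z t \<omega> \<partial>(I \<Otimes>\<^sub>M I))"
    by (intro Bochner_Integration.integral_cong sq) auto
  also have "\<dots> = (\<integral>(s, t). expectation (\<lambda>\<omega>. Z s \<omega> * Z t \<omega>) \<partial>(I \<Otimes>\<^sub>M I))"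
    using IIM.Fubini_integral[of "\<lambda>(s, t) \<omega>. Z s \<omega> * Z t \<omega>"] int_ZZ by (simp add: split_beta')
  also have "\<dots> \<le> (\<integral>z. \<bar>case z of (s, t) \<Rightarrow> expectation (\<lambda>\<omega>. Z s \<omega> * Z t \<omega>)\<bar> \<partial>(I \<Otimes>\<^sub>M I))"
    using integral_abs_bound by (rule order_trans[OF abs_ge_self])
  also have "\<dots> \<le> 2 * T * H"
  proof (rule integral_real_bounded)
    show "0 \<le> 2 * T * H" using T H by simp
    have E_abs: "(\<lambda>z. ennreal \<bar>case z of (s, t) \<Rightarrow> expectation (\<lambda>\<omega>. Z s \<omega> * Z t \<omega>)\<bar>) \<in> borel_measurable (I \<Otimes>\<^sub>M I)"
      using measurable_compose[OF E_meas, of "\<lambda>x. ennreal \<bar>x\<bar>" borel] by simp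
    have "(\<integral>\<^sup>+z. ennreal \<bar>case z of (s, t) \<Rightarrow> expectation (\<lambda>\<omega>. Z s \<omega> * Z t \<omega>)\<bar> \<partial>(I \<Otimes>\<^sub>M I)) =
        (\<integral>\<^sup>+s. (\<integral>\<^sup>+t. ennreal \<bar>expectation (\<lambda>\<omega>. Z s \<omega> * Z t \<omega>)\<bar> \<partial>I) \<partial>I)"
      using I.nn_integral_fst[OF E_abs] by simp
    also have "\<dots> \<le> (\<integral>\<^sup>+s. ennreal (2 * H) \<partial>I)"
      by (intro nn_integral_mono inner) (simp add: space_I)
    also have "\<dots> = ennreal (2 * T * H)"
      using T H(2) by (simp add: emeasure_I flip: ennreal_mult)
    finally show "(\<integral>\<^sup>+z. ennreal \<bar>case z of (s, t) \<Rightarrow> expectation (\<lambda>\<omega>. Z s \<omega> * Z t \<omega>)\<bar> \<partial>(I \<Otimes>\<^sub>M I))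
        \<le> ennreal (2 * T * H)"
      by simp
  qed
  finally show ?thesis .
qed

section \<open>Transition kernels and the Markov property at fixed times\<close>

lemma (in borel_right_process) prob_space_law: "prob_space (Pr x)" and sets_law: "sets (Pr x) = sets M"
  using measurable_space[OF kernel, of x] by (auto simp: space_prob_algebra)

lemma (in borel_right_process) space_law: "space (Pr x) = space M"
  by (rule sets_eq_imp_space_eq) (rule sets_law)

lemma (in borel_right_process) kernel_subprob: "Pr \<in> borel \<rightarrow>\<^sub>M subprob_algebra M"
  using kernel by (rule measurable_prob_algebraD)

lemma (in borel_right_process) measurable_X_law: "0 \<le> t \<Longrightarrow> X t \<in> Pr x \<rightarrow>\<^sub>M borel"
  using measurable_X sets_law by (simp cong: measurable_cong_sets)

lemma (in borel_right_process) transition_kernel: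
  assumes "0 \<le> t"
  shows "transition X Pr t \<in> borel \<rightarrow>\<^sub>M subprob_algebra borel"
  unfolding transition_def
  by (rule measurable_compose[OF kernel_subprob measurable_distr]) (rule measurable_X[OF assms])

lemma (in borel_right_process) prob_space_transition: "0 \<le> t \<Longrightarrow> prob_space (transition X Pr t x)"
  unfolding transition_def by (intro prob_space.prob_space_distr prob_space_law measurable_X_law)

lemma (in borel_right_process) emeasure_transition:
  "0 \<le> t \<Longrightarrow> B \<in> sets borel \<Longrightarrow>
    emeasure (transition X Pr t x) B = emeasure (Pr x) {\<omega>\<in>space M. X t \<omega> \<in> B}"
  unfolding transition_def
  by (subst emeasure_distr) (auto simp: measurable_X_law space_law intro!: arg_cong[where f="emeasure (Pr x)"])

text \<open>
  The simple Markov property is the strong Markov property at a deterministic time \<open>s\<close>: the event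
  \<open>X s \<in> A\<close> belongs to the history up to \<open>s\<close>, hence to the sigma-algebra of the constant stopping
  time \<open>s\<close>.
\<close>

lemma (in borel_right_process) markov_at_fixed_time:
  assumes s: "0 \<le> s" and t: "0 \<le> t" and A: "A \<in> sets borel" and B: "B \<in> sets borel"
  shows "emeasure (Pr x) {\<omega>\<in>space M. X s \<omega> \<in> A \<and> X (s + t) \<omega> \<in> B} =
    (\<integral>\<^sup>+\<omega>. indicator A (X s \<omega>) * emeasure (transition X Pr t (X s \<omega>)) B \<partial>Pr x)"
proof -
  interpret F: filtration "space M" "right_history M X"
    by (rule filtration_right_history)
  define E where "E = X s -` A \<inter> space M"
  have sub: "(\<Inter>v\<in>{v. u < v \<or> v = \<infinity>}. sets (history M X v)) \<subseteq> Pow (space M)" for u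
    using sets.sets_into_space[of _ "history M X \<infinity>"] by auto
  have gen: "{X r -` B \<inter> space M | r B. 0 \<le> r \<and> ennreal r \<le> v \<and> B \<in> sets borel} \<subseteq> Pow (space M)" for v
    by auto
  have E_sets: "E \<in> sets (right_history M X u)" if "ennreal s \<le> u" for u
  proof -
    have "E \<in> sets (history M X v)" if "u < v \<or> v = \<infinity>" for v
    proof -
      have "ennreal s \<le> v"
        using that \<open>ennreal s \<le> u\<close> by (metis dual_order.strict_iff_order order_trans top_greatest infinity_ennreal_def)
      then show ?thesis
        unfolding E_def history_def sets_measure_of[OF gen] using s A by (intro sigma_sets.Basic) blast
    qed
    then show ?thesis
      unfolding right_history_def sets_measure_of[OF sub] by (intro sigma_sets.Basic) auto
  qed
  have stop: "stopping_time (right_history M X) (\<lambda>\<omega>. ennreal s)"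
    by (rule stopping_time_const)
  have "E \<in> sets (F.pre_sigma (\<lambda>\<omega>. ennreal s))"
  proof (rule F.sets_pre_sigmaI[OF stop])
    fix u
    show "{\<omega> \<in> E. ennreal s \<le> u} \<in> sets (right_history M X u)"
      using E_sets[of u] by (cases "ennreal s \<le> u") simp_all
  qed
  from strong_markov[OF stop this t B, of x] s
  have "emeasure (Pr x) {\<omega> \<in> E. X (s + t) \<omega> \<in> B} =
      (\<integral>\<^sup>+\<omega>\<in>E. emeasure (transition X Pr t (X s \<omega>)) B \<partial>Pr x)"
    by simp
  also have "\<dots> = (\<integral>\<^sup>+\<omega>. indicator A (X s \<omega>) * emeasure (transition X Pr t (X s \<omega>)) B \<partial>Pr x)"
    by (intro nn_integral_cong) (auto simp: E_def space_law mult.commute split: split_indicator)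
  also have "{\<omega> \<in> E. X (s + t) \<omega> \<in> B} = {\<omega>\<in>space M. X s \<omega> \<in> A \<and> X (s + t) \<omega> \<in> B}"
    by (auto simp: E_def)
  finally show ?thesis .
qed

lemma (in borel_right_process) chapman_kolmogorov:
  assumes s: "0 \<le> s" and t: "0 \<le> t" and B: "B \<in> sets borel"
  shows "emeasure (transition X Pr (s + t) x) B =
    (\<integral>\<^sup>+y. emeasure (transition X Pr t y) B \<partial>transition X Pr s x)"
proof -
  note [measurable] = transition_kernel[OF t] B
  have "emeasure (transition X Pr (s + t) x) B =
      (\<integral>\<^sup>+\<omega>. emeasure (transition X Pr t (X s \<omega>)) B \<partial>Pr x)"
    using markov_at_fixed_time[OF s t _ B, of UNIV x] s t B by (simp add: emeasure_transition)
  also have "\<dots> = (\<integral>\<^sup>+y. emeasure (transition X Pr t y) B \<partial>transition X Pr s x)"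
    unfolding transition_def[of _ _ s]
    by (rule nn_integral_distr[symmetric]) (use s measurable_X_law in auto)
  finally show ?thesis .
qed

section \<open>The stationary process and its two-time laws\<close>

locale stationary_right_process = borel_right_process M X Pr
  for M :: "'w measure" and X :: "real \<Rightarrow> 'w \<Rightarrow> 'a::polish_space" and Pr +
  fixes \<mu> :: "'a measure"
  assumes invariant_prob: "invariant_prob (transition X Pr) \<mu>"

sublocale stationary_right_process \<subseteq> \<mu>: prob_space \<mu>
  using invariant_prob by (simp add: invariant_prob_def)

context stationary_right_process
begin

lemma sets_\<mu> [measurable_cong, simp]: "sets \<mu> = sets borel"
  using invariant_prob by (simp add: invariant_prob_def)

lemma space_\<mu> [simp]: "space \<mu> = UNIV"
  using sets_eq_imp_space_eq[OF sets_\<mu>] by simp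

definition stationary_law :: "'w measure" where
  "stationary_law = \<mu> \<bind> Pr"

lemma kernel_\<mu>: "Pr \<in> \<mu> \<rightarrow>\<^sub>M subprob_algebra M"
  using kernel_subprob by (simp cong: measurable_cong_sets)

lemma transition_kernel_\<mu>: "0 \<le> t \<Longrightarrow> transition X Pr t \<in> \<mu> \<rightarrow>\<^sub>M subprob_algebra borel"
  using transition_kernel by (simp cong: measurable_cong_sets)

lemma sets_stationary_law [measurable_cong, simp]: "sets stationary_law = sets M"
  unfolding stationary_law_def by (rule sets_bind) (simp_all add: sets_law)

lemma space_stationary_law [simp]: "space stationary_law = space M"
  by (rule sets_eq_imp_space_eq) simp

lemma measurable_X_stationary [measurable]: "0 \<le> t \<Longrightarrow> X t \<in> stationary_law \<rightarrow>\<^sub>M borel"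
  using measurable_X by (simp cong: measurable_cong_sets)

end

sublocale stationary_right_process \<subseteq> prob_space stationary_law
  unfolding stationary_law_def
  by (rule \<mu>.prob_space_bind[OF _ kernel_\<mu>]) (simp add: prob_space_law)

context stationary_right_process
begin

lemma distr_stationary:
  assumes "0 \<le> t"
  shows "distr stationary_law borel (X t) = \<mu>"
proof (rule measure_eqI)
  fix B assume "B \<in> sets (distr stationary_law borel (X t))"
  then have B: "B \<in> sets borel" by simp
  have "distr stationary_law borel (X t) = \<mu> \<bind> transition X Pr t"
    unfolding stationary_law_def
    by (subst distr_bind[OF kernel_\<mu>]) (simp_all add: measurable_X[OF assms] transition_def[abs_def])
  then show "emeasure (distr stationary_law borel (X t)) B = emeasure \<mu> B"
    using invariant_prob assms B
    by (simp add: emeasure_bind[OF _ transition_kernel_\<mu>] invariant_prob_def)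
qed simp

lemma nn_integral_X: "0 \<le> t \<Longrightarrow> g \<in> borel_measurable borel \<Longrightarrow>
    (\<integral>\<^sup>+\<omega>. g (X t \<omega>) \<partial>stationary_law) = (\<integral>\<^sup>+x. g x \<partial>\<mu>)"
  by (subst distr_stationary[symmetric, of t]) (simp_all add: nn_integral_distr)

lemma expectation_X:
  fixes g :: "'a \<Rightarrow> real"
  shows "0 \<le> t \<Longrightarrow> g \<in> borel_measurable borel \<Longrightarrow> expectation (\<lambda>\<omega>. g (X t \<omega>)) = (\<integral>x. g x \<partial>\<mu>)"
  by (subst distr_stationary[symmetric, of t]) (simp_all add: integral_distr)

lemma emeasure_two_times:
  assumes s: "0 \<le> s" and t: "0 \<le> t" and A [measurable]: "A \<in> sets borel" and B [measurable]: "B \<in> sets borel"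
  shows "emeasure stationary_law {\<omega>\<in>space M. X s \<omega> \<in> A \<and> X (s + t) \<omega> \<in> B} =
    (\<integral>\<^sup>+x. indicator A x * emeasure (transition X Pr t x) B \<partial>\<mu>)"
proof -
  note [measurable] = transition_kernel[OF t] measurable_X[OF s] measurable_X[of "s + t"]
  have [measurable]: "X (s + t) \<in> M \<rightarrow>\<^sub>M borel"
    using s t by simp
  have "emeasure stationary_law {\<omega>\<in>space M. X s \<omega> \<in> A \<and> X (s + t) \<omega> \<in> B} =
      (\<integral>\<^sup>+x. (\<integral>\<^sup>+\<omega>. indicator A (X s \<omega>) * emeasure (transition X Pr t (X s \<omega>)) B \<partial>Pr x) \<partial>\<mu>)"
    unfolding stationary_law_def
    by (subst emeasure_bind[OF _ kernel_\<mu>]) (simp_all add: markov_at_fixed_time[OF s t A B])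
  also have "\<dots> = (\<integral>\<^sup>+\<omega>. indicator A (X s \<omega>) * emeasure (transition X Pr t (X s \<omega>)) B \<partial>stationary_law)"
    unfolding stationary_law_def by (rule nn_integral_bind[OF _ kernel_\<mu>, symmetric]) measurable
  also have "\<dots> = (\<integral>\<^sup>+x. indicator A x * emeasure (transition X Pr t x) B \<partial>\<mu>)"
    by (rule nn_integral_X[OF s]) measurable
  finally show ?thesis .
qed

text \<open>
  Both sides agree on rectangles, which form an intersection-stable generator. In this form the two-time
  law turns expectations of products into integrals against the transition kernel.
\<close>

lemma joint_law:
  assumes s: "0 \<le> s" and t: "0 \<le> t"
  shows "distr stationary_law (borel \<Otimes>\<^sub>M borel) (\<lambda>\<omega>. (X s \<omega>, X (s + t) \<omega>)) =
    \<mu> \<bind> (\<lambda>x. distr (transition X Pr t x) (borel \<Otimes>\<^sub>M borel) (Pair x))"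
    (is "?L = ?R")
proof (rule measure_eqI_generator_eq[where \<Omega>=UNIV and A="\<lambda>_. UNIV"
      and E="{a \<times> b | a b. a \<in> sets (borel :: 'a measure) \<and> b \<in> sets (borel :: 'a measure)}"])
  have st: "0 \<le> s + t" using s t by simp
  note [measurable] = transition_kernel[OF t] transition_kernel_\<mu>[OF t] measurable_X_stationary[OF s] measurable_X_stationary[OF st]
  have K: "(\<lambda>x. distr (transition X Pr t x) (borel \<Otimes>\<^sub>M borel) (Pair x)) \<in> \<mu> \<rightarrow>\<^sub>M subprob_algebra (borel \<Otimes>\<^sub>M borel)"
    by (rule measurable_distr2[where M=borel]) measurable
  show "Int_stable {a \<times> b | a b. a \<in> sets (borel :: 'a measure) \<and> b \<in> sets (borel :: 'a measure)}"
    by (rule Int_stable_pair_measure_generator)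
  show "sets ?L = sigma_sets UNIV {a \<times> b | a b. a \<in> sets (borel :: 'a measure) \<and> b \<in> sets (borel :: 'a measure)}"
    by (simp add: sets_pair_measure)
  have "sets ?R = sets ((borel :: 'a measure) \<Otimes>\<^sub>M (borel :: 'a measure))"
    by (rule sets_bind) simp_all
  then show "sets ?R = sigma_sets UNIV {a \<times> b | a b. a \<in> sets (borel :: 'a measure) \<and> b \<in> sets (borel :: 'a measure)}"
    by (simp add: sets_pair_measure)
  show "emeasure ?L UNIV \<noteq> \<infinity>"
    by (rule finite_measure.emeasure_finite[OF finite_measure_distr, unfolded infinity_ennreal_def[symmetric]]) measurable
  fix C assume "C \<in> {a \<times> b | a b. a \<in> sets (borel :: 'a measure) \<and> b \<in> sets (borel :: 'a measure)}"
  then obtain A B where C: "C = A \<times> B" and [measurable]: "A \<in> sets borel" "B \<in> sets borel"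
    by auto
  have "emeasure ?L C = emeasure stationary_law {\<omega>\<in>space M. X s \<omega> \<in> A \<and> X (s + t) \<omega> \<in> B}"
    unfolding C by (subst emeasure_distr) (auto intro!: arg_cong[where f="emeasure stationary_law"])
  also have "\<dots> = (\<integral>\<^sup>+x. indicator A x * emeasure (transition X Pr t x) B \<partial>\<mu>)"
    by (rule emeasure_two_times) (use s t in auto)
  also have "\<dots> = (\<integral>\<^sup>+x. emeasure (distr (transition X Pr t x) (borel \<Otimes>\<^sub>M borel) (Pair x)) C \<partial>\<mu>)"
  proof (rule nn_integral_cong)
    fix x
    have sets: "sets (transition X Pr t x) = sets borel" by (simp add: transition_def)
    have "Pair x \<in> transition X Pr t x \<rightarrow>\<^sub>M borel \<Otimes>\<^sub>M borel"
      using sets by (simp cong: measurable_cong_sets)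
    then show "indicator A x * emeasure (transition X Pr t x) B =
        emeasure (distr (transition X Pr t x) (borel \<Otimes>\<^sub>M borel) (Pair x)) C"
      unfolding C by (subst emeasure_distr) (auto simp: sets_eq_imp_space_eq[OF sets] vimage_def split: split_indicator)
  qed
  also have "\<dots> = emeasure ?R C"
    unfolding C by (rule emeasure_bind[OF _ K, symmetric]) auto
  finally show "emeasure ?L C = emeasure ?R C" .
qed (auto intro!: exI[of _ UNIV])

lemma expectation_two_times:
  fixes g h :: "'a \<Rightarrow> real"
  assumes s: "0 \<le> s" and t: "0 \<le> t"
    and g [measurable]: "g \<in> borel_measurable borel" and h [measurable]: "h \<in> borel_measurable borel"
    and b: "\<And>x. \<bar>g x\<bar> \<le> a" "\<And>x. \<bar>h x\<bar> \<le> b"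
  shows "expectation (\<lambda>\<omega>. g (X s \<omega>) * h (X (s + t) \<omega>)) =
    (\<integral>x. g x * (\<integral>y. h y \<partial>transition X Pr t x) \<partial>\<mu>)"
proof -
  have st: "0 \<le> s + t" using s t by simp
  note [measurable] = transition_kernel[OF t] transition_kernel_\<mu>[OF t] measurable_X_stationary[OF s] measurable_X_stationary[OF st]
  have K: "(\<lambda>x. distr (transition X Pr t x) (borel \<Otimes>\<^sub>M borel) (Pair x)) \<in> \<mu> \<rightarrow>\<^sub>M subprob_algebra (borel \<Otimes>\<^sub>M borel)"
    by (rule measurable_distr2[where M=borel]) measurable
  have "expectation (\<lambda>\<omega>. g (X s \<omega>) * h (X (s + t) \<omega>)) =
      (\<integral>(x, y). g x * h y \<partial>distr stationary_law (borel \<Otimes>\<^sub>M borel) (\<lambda>\<omega>. (X s \<omega>, X (s + t) \<omega>)))"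
    by (subst integral_distr) simp_all
  also have "\<dots> = (\<integral>x. (\<integral>z. (case z of (x, y) \<Rightarrow> g x * h y)
      \<partial>distr (transition X Pr t x) (borel \<Otimes>\<^sub>M borel) (Pair x)) \<partial>\<mu>)"
    unfolding joint_law[OF s t]
  proof (rule integral_bind[OF _ _ K, where B'=1 and B="a * b"])
    show "\<bar>case z of (x, y) \<Rightarrow> g x * h y\<bar> \<le> a * b" for z
      using b[of "fst z"] b[of "snd z"]
      by (auto simp: case_prod_beta abs_mult intro!: mult_mono intro: order_trans[OF abs_ge_zero])
    show "finite_measure \<mu>"
      by (rule \<mu>.finite_measure_axioms)
    show "AE x in \<mu>. emeasure (distr (transition X Pr t x) (borel \<Otimes>\<^sub>M borel) (Pair x))
        (space (distr (transition X Pr t x) (borel \<Otimes>\<^sub>M borel) (Pair x))) \<le> ennreal 1"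
      using K[THEN measurable_space]
      by (intro AE_I2) (auto simp: space_subprob_algebra subprob_space.subprob_emeasure_le_1)
  qed measurable
  also have "\<dots> = (\<integral>x. g x * (\<integral>y. h y \<partial>transition X Pr t x) \<partial>\<mu>)"
    by (intro Bochner_Integration.integral_cong refl, subst integral_distr) (simp_all add: transition_def)
  finally show ?thesis .
qed

end

section \<open>Variance and covariance bounds in stationarity\<close>

lemma (in prob_space) abs_expectation_le:
  fixes h :: "'a \<Rightarrow> real"
  assumes "h \<in> borel_measurable M" "\<And>x. \<bar>h x\<bar> \<le> c"
  shows "\<bar>expectation h\<bar> \<le> c"
proof -
  have "integrable M h"
    by (rule integrable_const_bound[where B=c]) (use assms in auto)
  then have "expectation (\<lambda>x. \<bar>h x\<bar>) \<le> c"
    by (intro integral_le_const integrable_abs) (use assms in auto)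
  then show ?thesis
    using integral_abs_bound order_trans by blast
qed

context stationary_right_process
begin

text \<open>
  The variance is the smallest mean square deviation from a constant. Comparing with \<open>T m\<close> for any
  centring \<open>m\<close> of \<open>f\<close> avoids computing the mean of the time integral.
\<close>

lemma variance_time_integral_le:
  fixes f :: "'a \<Rightarrow> real" and D :: "real \<Rightarrow> real"
  assumes T: "0 \<le> T"
    and f [measurable]: "f \<in> borel_measurable borel" and bound: "\<And>x. \<bar>f x\<bar> \<le> b"
    and cov: "\<And>s u. 0 \<le> s \<Longrightarrow> 0 < u \<Longrightarrow>
      \<bar>expectation (\<lambda>\<omega>. (f (X s \<omega>) - m) * (f (X (s + u) \<omega>) - m))\<bar> \<le> D u"
    and D: "D \<in> borel_measurable borel"
    and H: "(\<integral>\<^sup>+u. ennreal (D u) * indicator {0<..} u \<partial>lborel) \<le> ennreal H" "0 \<le> H"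
  shows "variance (\<lambda>\<omega>. LBINT t:{0..T}. f (X t \<omega>)) \<le> 2 * T * H"
proof -
  define Y where "Y \<omega> = (LBINT t:{0..T}. f (X t \<omega>))" for \<omega>
  \<comment> \<open>Freezing the process at negative times makes it right-continuous on the whole line.\<close>
  define Z where "Z t \<omega> = f (X (max 0 t) \<omega>)" for t \<omega>
  have "(\<lambda>(t, \<omega>). X (max 0 t) \<omega>) \<in> borel \<Otimes>\<^sub>M stationary_law \<rightarrow>\<^sub>M borel"
  proof (rule right_continuous_process_measurable)
    fix t :: real
    show "X (max 0 t) \<in> stationary_law \<rightarrow>\<^sub>M borel"
      by (rule measurable_X_stationary) simp
    fix \<omega> assume "\<omega> \<in> space stationary_law"
    then have \<omega>: "\<omega> \<in> space M" by simp
    show "continuous (at_right t) (\<lambda>s. X (max 0 s) \<omega>)"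
    proof (cases "0 \<le> t")
      case True
      with right_continuous[OF \<omega> True] show ?thesis
        unfolding continuous_within
        by (rule_tac Lim_transform_within[where d=1]) auto
    next
      case False
      then have "((\<lambda>s. X 0 \<omega>) \<longlongrightarrow> X (max 0 t) \<omega>) (at_right t)"
        by (simp add: max_def)
      then show ?thesis
        unfolding continuous_within
        by (rule Lim_transform_within[where d="- t"]) (use False in \<open>auto simp: dist_real_def max_def\<close>)
    qed
  qed
  from measurable_compose[OF this f]
  have Z [measurable]: "(\<lambda>(t, \<omega>). Z t \<omega>) \<in> borel_measurable (borel \<Otimes>\<^sub>M stationary_law)"
    by (simp add: Z_def split_beta')
  have Zb: "\<bar>Z t \<omega>\<bar> \<le> b" for t \<omega>
    unfolding Z_def by (rule bound)
  have Zt [measurable]: "(\<lambda>t. Z t \<omega>) \<in> borel_measurable borel" if "\<omega> \<in> space M" for \<omega>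
    using measurable_compose[OF measurable_Pair2' Z, of \<omega>] that by simp
  have Y_Z: "Y \<omega> = (LBINT t:{0..T}. Z t \<omega>)" for \<omega>
    unfolding Y_def Z_def by (rule set_lebesgue_integral_cong) auto
  have int_Z: "set_integrable lborel {0..T} (\<lambda>t. Z t \<omega>)" if "\<omega> \<in> space M" for \<omega>
    unfolding set_integrable_def
  proof (rule Bochner_Integration.integrable_bound)
    show "integrable lborel (\<lambda>t. indicator {0..T} t *\<^sub>R b)"
      by (intro integrable_scaleR_left integrable_real_indicator) (auto simp: emeasure_lborel_Icc_eq)
    show "(\<lambda>t. indicator {0..T} t *\<^sub>R Z t \<omega>) \<in> borel_measurable lborel"
      using Zt[OF that] by measurable
    show "AE t in lborel. norm (indicator {0..T} t *\<^sub>R Z t \<omega>) \<le> norm (indicator {0..T} t *\<^sub>R b)"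
      using Zb by (auto split: split_indicator intro: order_trans[OF Zb abs_ge_self])
  qed
  have Y_meas [measurable]: "Y \<in> borel_measurable stationary_law"
  proof -
    have "(\<lambda>(\<omega>, t). indicator {0..T} t *\<^sub>R Z t \<omega>) \<in> borel_measurable (stationary_law \<Otimes>\<^sub>M lborel)"
      using measurable_compose[OF measurable_pair_swap' Z] by (simp add: split_beta')
    then show ?thesis
      unfolding Y_Z[abs_def] set_lebesgue_integral_def
      by (rule lborel.borel_measurable_lebesgue_integral)
  qed
  have Y_bound: "\<bar>Y \<omega>\<bar> \<le> T * b" if "\<omega> \<in> space M" for \<omega>
  proof -
    have "\<bar>Y \<omega>\<bar> \<le> (LBINT t:{0..T}. \<bar>Z t \<omega>\<bar>)"
      using set_integral_norm_bound[OF int_Z[OF that]] by (simp add: Y_Z)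
    also have "\<dots> \<le> (LBINT t:{0..T}. b)"
      by (rule set_integral_mono) (use int_Z[OF that, THEN set_integrable_abs] Zb in \<open>auto simp: set_integrable_def emeasure_lborel_Icc_eq\<close>)
    also have "\<dots> = T * b"
      using T by (simp add: set_lebesgue_integral_def)
    finally show ?thesis .
  qed
  have int_Y: "integrable stationary_law Y"
    by (rule integrable_const_bound[where B="T * b"]) (use Y_bound in auto)
  have int_Y2: "integrable stationary_law (\<lambda>\<omega>. (Y \<omega>)\<^sup>2)"
    by (rule integrable_const_bound[where B="(T * b)\<^sup>2"])
       (use power_mono[OF Y_bound, where n=2] in \<open>auto\<close>)
  have "variance Y \<le> variance Y + (expectation Y - T * m)\<^sup>2"
    by simp
  also have "\<dots> = expectation (\<lambda>\<omega>. (Y \<omega> - T * m)\<^sup>2)"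
    using int_Y int_Y2 prob_space by (simp add: variance_eq power2_diff power2_eq_square[of "expectation Y"])
  also have "\<dots> = expectation (\<lambda>\<omega>. (LBINT t:{0..T}. Z t \<omega> - m)\<^sup>2)"
  proof (intro Bochner_Integration.integral_cong refl)
    fix \<omega> assume "\<omega> \<in> space stationary_law"
    then have "\<omega> \<in> space M" by simp
    then have "(LBINT t:{0..T}. Z t \<omega> - m) = Y \<omega> - (LBINT t:{0..T}. m)"
      unfolding Y_Z by (intro set_integral_diff int_Z) (auto simp: set_integrable_def emeasure_lborel_Icc_eq)
    also have "(LBINT t:{0..T}. m) = T * m"
      using T by (simp add: set_lebesgue_integral_def)
    finally show "(Y \<omega> - T * m)\<^sup>2 = (LBINT t:{0..T}. Z t \<omega> - m)\<^sup>2"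
      by simp
  qed
  also have "\<dots> \<le> 2 * T * H"
  proof (rule second_moment_time_integral_le[OF T _ _ _ D H])
    show "(\<lambda>(t, \<omega>). Z t \<omega> - m) \<in> borel_measurable (borel \<Otimes>\<^sub>M stationary_law)"
      using borel_measurable_diff[OF Z borel_measurable_const[of m]] by (simp add: split_beta')
    show "\<bar>Z t \<omega> - m\<bar> \<le> b + \<bar>m\<bar>" for t \<omega>
      using Zb[of t \<omega>] by linarith
    show "\<bar>expectation (\<lambda>\<omega>. (Z s \<omega> - m) * (Z (s + u) \<omega> - m))\<bar> \<le> D u" if "0 \<le> s" "0 < u" for s u
      using cov[OF that] that by (simp add: Z_def max_def)
  qed
  finally show ?thesis
    unfolding Y_def .
qed

text \<open>
  If \<open>f\<close> lives on \<open>S\<close>, then \<open>f (X s) f (X (s + u))\<close> vanishes unless the process is in \<open>S\<close> at both times.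
  By the Markov property this has probability at most \<open>q \<mu>(S)\<close>, where \<open>q\<close> bounds the chance of being in
  \<open>S\<close> after time \<open>u\<close> from any starting point; the square of the mean contributes \<open>\<mu>(S)\<^sup>2\<close>. Besides
  bounds from the transition density, the trivial choice \<open>q = 1\<close> is useful for very short lags.
\<close>

lemma covariance_le_return_probability:
  fixes f :: "'a \<Rightarrow> real"
  assumes s: "0 \<le> s" and u: "0 \<le> u"
    and f [measurable]: "f \<in> borel_measurable borel" and S [measurable]: "S \<in> sets borel"
    and bound: "\<And>x. \<bar>f x\<bar> \<le> b * indicator S x"
    and q: "\<And>x. emeasure (transition X Pr u x) S \<le> ennreal q" "0 \<le> q"
  defines "m \<equiv> \<integral>x. f x \<partial>\<mu>"
  shows "\<bar>expectation (\<lambda>\<omega>. (f (X s \<omega>) - m) * (f (X (s + u) \<omega>) - m))\<bar>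
    \<le> b\<^sup>2 * measure \<mu> S * (q + measure \<mu> S)"
proof -
  have su: "0 \<le> s + u" using s u by simp
  note [measurable] = measurable_X_stationary[OF s] measurable_X_stationary[OF su]
  have bb: "\<bar>f x\<bar> \<le> \<bar>b\<bar>" for x
    using bound[of x] by (auto split: split_indicator_asm)
  have int1: "integrable stationary_law (\<lambda>\<omega>. f (X s \<omega>))" "integrable stationary_law (\<lambda>\<omega>. f (X (s + u) \<omega>))"
    by (rule integrable_const_bound[where B="\<bar>b\<bar>"]; use bb in simp)+
  have int2: "integrable stationary_law (\<lambda>\<omega>. f (X s \<omega>) * f (X (s + u) \<omega>))"
    by (rule integrable_const_bound[where B="\<bar>b\<bar> * \<bar>b\<bar>"])
       (simp_all add: abs_mult mult_mono bb del: abs_mult_self_eq)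
  have E1: "expectation (\<lambda>\<omega>. f (X s \<omega>)) = m" "expectation (\<lambda>\<omega>. f (X (s + u) \<omega>)) = m"
    unfolding m_def by (rule expectation_X[OF s f], rule expectation_X[OF su f])
  have "expectation (\<lambda>\<omega>. (f (X s \<omega>) - m) * (f (X (s + u) \<omega>) - m)) =
      expectation (\<lambda>\<omega>. f (X s \<omega>) * f (X (s + u) \<omega>) - m * f (X s \<omega>) - m * f (X (s + u) \<omega>) + m * m)"
    by (simp add: algebra_simps)
  also have "\<dots> = expectation (\<lambda>\<omega>. f (X s \<omega>) * f (X (s + u) \<omega>)) - m\<^sup>2"
    using int1 int2 E1 prob_space by (simp add: power2_eq_square)
  finally have eq: "expectation (\<lambda>\<omega>. (f (X s \<omega>) - m) * (f (X (s + u) \<omega>) - m)) =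
      expectation (\<lambda>\<omega>. f (X s \<omega>) * f (X (s + u) \<omega>)) - m\<^sup>2" .
  let ?E = "{\<omega>\<in>space M. X s \<omega> \<in> S \<and> X (s + u) \<omega> \<in> S}"
  have E_sets: "?E \<in> sets stationary_law"
  proof -
    have "{\<omega>\<in>space stationary_law. X s \<omega> \<in> S \<and> X (s + u) \<omega> \<in> S} \<in> sets stationary_law"
      by measurable
    then show ?thesis by simp
  qed
  have "emeasure stationary_law ?E = (\<integral>\<^sup>+x. indicator S x * emeasure (transition X Pr u x) S \<partial>\<mu>)"
    by (rule emeasure_two_times) (use s u in auto)
  also have "\<dots> \<le> (\<integral>\<^sup>+x. ennreal q * indicator S x \<partial>\<mu>)"
    by (intro nn_integral_mono) (auto simp: q split: split_indicator)
  also have "\<dots> = ennreal (q * measure \<mu> S)"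
    using q(2) by (simp add: nn_integral_cmult_indicator \<mu>.emeasure_eq_measure ennreal_mult)
  finally have prob_E: "prob ?E \<le> q * measure \<mu> S"
    using q(2) by (simp add: emeasure_eq_measure)
  have "\<bar>expectation (\<lambda>\<omega>. f (X s \<omega>) * f (X (s + u) \<omega>))\<bar> \<le> expectation (\<lambda>\<omega>. \<bar>f (X s \<omega>) * f (X (s + u) \<omega>)\<bar>)"
    by (rule integral_abs_bound)
  also have "\<dots> \<le> expectation (\<lambda>\<omega>. b\<^sup>2 * indicator ?E \<omega>)"
  proof (rule integral_mono)
    fix \<omega> assume "\<omega> \<in> space stationary_law"
    moreover have "\<bar>f (X s \<omega>)\<bar> * \<bar>f (X (s + u) \<omega>)\<bar> \<le> (b * indicator S (X s \<omega>)) * (b * indicator S (X (s + u) \<omega>))"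
      by (intro mult_mono bound order_trans[OF abs_ge_zero bound]) simp
    ultimately show "\<bar>f (X s \<omega>) * f (X (s + u) \<omega>)\<bar> \<le> b\<^sup>2 * indicator ?E \<omega>"
      by (auto simp: abs_mult power2_eq_square split: split_indicator_asm)
  next
    show "integrable stationary_law (\<lambda>\<omega>. b\<^sup>2 * indicator ?E \<omega>)"
      by (intro integrable_mult_right integrable_real_indicator E_sets) (simp add: emeasure_eq_measure)
  qed (use int2 in auto)
  also have "\<dots> = b\<^sup>2 * prob ?E"
    using sets.sets_into_space[OF E_sets] by (simp add: Int_absorb2)
  also have "\<dots> \<le> b\<^sup>2 * (q * measure \<mu> S)"
    by (intro mult_left_mono prob_E) simp
  finally have E2: "\<bar>expectation (\<lambda>\<omega>. f (X s \<omega>) * f (X (s + u) \<omega>))\<bar> \<le> b\<^sup>2 * (q * measure \<mu> S)" .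
  have "\<bar>m\<bar> \<le> (\<integral>x. \<bar>f x\<bar> \<partial>\<mu>)"
    unfolding m_def by (rule integral_abs_bound)
  also have "\<dots> \<le> (\<integral>x. b * indicator S x \<partial>\<mu>)"
  proof (rule integral_mono[OF _ _ bound])
    show "integrable \<mu> (\<lambda>x. \<bar>f x\<bar>)"
      by (rule \<mu>.integrable_const_bound[where B="\<bar>b\<bar>"]) (use bb in auto)
    show "integrable \<mu> (\<lambda>x. b * indicator S x)"
      by (intro integrable_mult_right integrable_real_indicator) (simp_all add: \<mu>.emeasure_eq_measure)
  qed
  also have "\<dots> = b * measure \<mu> S"
    by simp
  finally have "m\<^sup>2 \<le> (b * measure \<mu> S)\<^sup>2"
    by (metis abs_ge_zero power2_abs power_mono)
  with E2 zero_le_power2[of m]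
  have "\<bar>expectation (\<lambda>\<omega>. f (X s \<omega>) * f (X (s + u) \<omega>)) - m\<^sup>2\<bar> \<le> b\<^sup>2 * (q * measure \<mu> S) + (b * measure \<mu> S)\<^sup>2"
    by linarith
  then show ?thesis
    unfolding eq by (simp add: power2_eq_square algebra_simps)
qed

text \<open>
  Conditioning on \<open>X s\<close> replaces \<open>f (X (s + u)) - m\<close> by \<open>P\<^sub>u f - m\<close>, which is at most \<open>b\<close> times the total
  variation distance between \<open>P\<^sub>u(x, \<cdot>)\<close> and \<open>\<mu>\<close>; the other factor is at most \<open>2 b\<close>.
\<close>

lemma covariance_le_mixing:
  fixes f :: "'a \<Rightarrow> real"
  assumes s: "0 \<le> s" and u: "0 \<le> u"
    and f [measurable]: "f \<in> borel_measurable borel" and bound: "\<And>x. \<bar>f x\<bar> \<le> b"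
    and \<beta>: "(\<integral>\<^sup>+x. ennreal (tv_norm_diff (transition X Pr u x) \<mu>) \<partial>\<mu>) \<le> ennreal \<beta>" "0 \<le> \<beta>"
  defines "m \<equiv> \<integral>x. f x \<partial>\<mu>"
  shows "\<bar>expectation (\<lambda>\<omega>. (f (X s \<omega>) - m) * (f (X (s + u) \<omega>) - m))\<bar> \<le> 2 * b\<^sup>2 * \<beta>"
proof -
  define g where "g x = (\<integral>y. f y \<partial>transition X Pr u x) - m" for x
  have b: "0 \<le> b" using bound[of undefined] by linarith
  note [measurable] = transition_kernel[OF u]
  have g_meas [measurable]: "g \<in> borel_measurable borel"
    unfolding g_def by measurable
  have P_int: "integrable (transition X Pr u x) f" for x
  proof -
    interpret P: prob_space "transition X Pr u x"
      by (rule prob_space_transition[OF u])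
    show ?thesis
      by (rule P.integrable_const_bound[where B=b]) (use bound in \<open>auto simp: transition_def\<close>)
  qed
  have m_le: "\<bar>m\<bar> \<le> b"
    unfolding m_def
    by (rule \<mu>.abs_expectation_le) (use bound in auto)
  have tv: "\<bar>g x\<bar> \<le> b * tv_norm_diff (transition X Pr u x) \<mu>" for x
  proof (cases "b = 0")
    case True
    then have "f = (\<lambda>x. 0)" using bound by (auto simp: fun_eq_iff)
    then show ?thesis using True by (simp add: g_def m_def)
  next
    case False
    with b have b: "0 < b" by simp
    let ?G = "{h \<in> borel_measurable (borel :: 'a measure). \<forall>x. \<bar>h x\<bar> \<le> (1::real)}"
    let ?\<Delta> = "\<lambda>h. \<bar>(\<integral>y. h y \<partial>transition X Pr u x) - (\<integral>y. h y \<partial>\<mu>)\<bar>"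
    interpret P: prob_space "transition X Pr u x"
      by (rule prob_space_transition[OF u])
    have "bdd_above (?\<Delta> ` ?G)"
    proof (rule bdd_aboveI2)
      fix h assume h: "h \<in> ?G"
      have "\<bar>\<integral>y. h y \<partial>transition X Pr u x\<bar> \<le> 1"
        by (rule P.abs_expectation_le) (use h in \<open>auto simp: transition_def\<close>)
      moreover have "\<bar>\<integral>y. h y \<partial>\<mu>\<bar> \<le> 1"
        by (rule \<mu>.abs_expectation_le) (use h in auto)
      ultimately show "?\<Delta> h \<le> 2" by linarith
    qed
    moreover have "(\<lambda>y. f y / b) \<in> ?G"
      using bound b by (auto simp: divide_le_eq)
    ultimately have "?\<Delta> (\<lambda>y. f y / b) \<le> tv_norm_diff (transition X Pr u x) \<mu>"
      unfolding tv_norm_diff_def by (rule cSUP_upper[rotated])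
    moreover have "?\<Delta> (\<lambda>y. f y / b) = \<bar>g x\<bar> / b"
      using b by (simp add: g_def m_def flip: diff_divide_distrib)
    ultimately show ?thesis
      using b by (simp add: divide_le_eq mult.commute)
  qed
  have "expectation (\<lambda>\<omega>. (f (X s \<omega>) - m) * (f (X (s + u) \<omega>) - m)) =
      (\<integral>x. (f x - m) * (\<integral>y. f y - m \<partial>transition X Pr u x) \<partial>\<mu>)"
    by (rule expectation_two_times[OF s u, where a="b + \<bar>m\<bar>" and b="b + \<bar>m\<bar>"])
       (use bound in \<open>auto intro: order_trans[OF abs_triangle_ineq4] add_right_mono\<close>)
  also have "\<dots> = (\<integral>x. (f x - m) * g x \<partial>\<mu>)"
    using P_int prob_space.prob_space[OF prob_space_transition[OF u]] prob_space.finite_measure[OF prob_space_transition[OF u]]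
    by (simp add: g_def finite_measure.integrable_const Bochner_Integration.integral_diff)
  finally have eq: "expectation (\<lambda>\<omega>. (f (X s \<omega>) - m) * (f (X (s + u) \<omega>) - m)) = (\<integral>x. (f x - m) * g x \<partial>\<mu>)" .
  have "\<bar>\<integral>x. (f x - m) * g x \<partial>\<mu>\<bar> \<le> (\<integral>x. \<bar>(f x - m) * g x\<bar> \<partial>\<mu>)"
    by (rule integral_abs_bound)
  also have "\<dots> \<le> 2 * b\<^sup>2 * \<beta>"
  proof (rule integral_real_bounded)
    show "0 \<le> 2 * b\<^sup>2 * \<beta>" using \<beta>(2) by simp
    have "(\<integral>\<^sup>+x. ennreal \<bar>(f x - m) * g x\<bar> \<partial>\<mu>) \<le> (\<integral>\<^sup>+x. ennreal (2 * b) * ennreal \<bar>g x\<bar> \<partial>\<mu>)"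
    proof (rule nn_integral_mono)
      fix x
      have "\<bar>f x - m\<bar> \<le> 2 * b" using bound[of x] m_le by linarith
      then show "ennreal \<bar>(f x - m) * g x\<bar> \<le> ennreal (2 * b) * ennreal \<bar>g x\<bar>"
        using b by (simp add: abs_mult mult_right_mono flip: ennreal_mult)
    qed
    also have "\<dots> = ennreal (2 * b) * (\<integral>\<^sup>+x. ennreal \<bar>g x\<bar> \<partial>\<mu>)"
      by (rule nn_integral_cmult) measurable
    also have "\<dots> \<le> ennreal (2 * b) * ennreal (b * \<beta>)"
    proof (rule mult_left_mono)
      \<comment> \<open>The total variation distance need not be measurable in \<open>x\<close>; the factor \<open>b\<close> is therefore moved
        to the measurable side before comparing integrals.\<close>
      show "(\<integral>\<^sup>+x. ennreal \<bar>g x\<bar> \<partial>\<mu>) \<le> ennreal (b * \<beta>)"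
      proof (cases "b = 0")
        case True
        then show ?thesis using tv by (simp add: \<open>0 \<le> b\<close>)
      next
        case False
        with b have b: "0 < b" by simp
        have "(\<integral>\<^sup>+x. ennreal \<bar>g x\<bar> \<partial>\<mu>) = (\<integral>\<^sup>+x. ennreal b * ennreal (\<bar>g x\<bar> / b) \<partial>\<mu>)"
          using b by (simp flip: ennreal_mult)
        also have "\<dots> = ennreal b * (\<integral>\<^sup>+x. ennreal (\<bar>g x\<bar> / b) \<partial>\<mu>)"
          by (rule nn_integral_cmult) measurable
        also have "(\<integral>\<^sup>+x. ennreal (\<bar>g x\<bar> / b) \<partial>\<mu>) \<le> (\<integral>\<^sup>+x. ennreal (tv_norm_diff (transition X Pr u x) \<mu>) \<partial>\<mu>)"
          by (intro nn_integral_mono ennreal_leI) (use tv b in \<open>simp add: divide_le_eq mult.commute\<close>)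
        also note \<beta>(1)
        finally show ?thesis
          using b \<beta>(2) by (simp add: ennreal_mult mult_left_mono)
      qed
    qed simp
    also have "\<dots> = ennreal (2 * b\<^sup>2 * \<beta>)"
      using b \<beta>(2) by (simp add: power2_eq_square ac_simps flip: ennreal_mult)
    finally show "(\<integral>\<^sup>+x. ennreal \<bar>(f x - m) * g x\<bar> \<partial>\<mu>) \<le> ennreal (2 * b\<^sup>2 * \<beta>)" .
  qed
  finally show ?thesis
    unfolding eq .
qed

end

section \<open>Integrating the covariance envelope\<close>

text \<open>
  The lag \<open>\<delta>\<close> below which the density bound \<open>u powr (- d / 2)\<close> is worse than the trivial one. It is \<open>l\<close> for
  \<open>d = 2\<close> and \<open>l powr (2 / d)\<close> for \<open>d \<ge> 3\<close>, the order of time a diffusion needs to leave a ball of volume \<open>l\<close>. This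
  choice balances the two contributions \<open>l \<delta>\<close> and \<open>l\<^sup>2 \<integral>\<^sub>\<delta>\<^sup>1 u powr (- d / 2) du\<close>, up to constants, at
  \<open>l\<^sup>2 (psi d l)\<^sup>2\<close>: for \<open>d = 2\<close> the integral is the logarithm in \<open>psi\<close>, for \<open>d \<ge> 3\<close> it is of order
  \<open>\<delta> powr (1 - d / 2) = l powr (2 / d - 1)\<close>. The factor \<open>3\<close> is the worst case, \<open>d = 3\<close>, of \<open>1 / (1 - 2 / d)\<close>
  in the comparison of the logarithm with a power.
\<close>

lemma dimension_scale:
  fixes l :: real
  assumes d: "2 \<le> d" and l: "0 < l" "l < 1"
  obtains \<delta> where "0 < \<delta>" "\<delta> \<le> l * (psi d l)\<^sup>2"
    "(\<integral>\<^sup>+u. ennreal (u powr (- real d / 2)) * indicator {\<delta>..1} u \<partial>lborel) \<le> ennreal (2 * (psi d l)\<^sup>2)"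
    "ln (1 / l) \<le> 3 * (psi d l)\<^sup>2" "1 \<le> (psi d l)\<^sup>2"
proof (cases "d = 2")
  case True
  define L where "L = ln (1 / l)"
  have L: "0 \<le> L" "ln 1 - ln l = L"
    using l by (simp_all add: L_def ln_div)
  then have psi: "(psi d l)\<^sup>2 = 1 + L"
    using True by (simp add: psi_def L_def)
  have "(\<integral>\<^sup>+u. ennreal (u powr (- real d / 2)) * indicator {l..1} u \<partial>lborel) =
      (\<integral>\<^sup>+u. ennreal (1 / u) * indicator {l..1} u \<partial>lborel)"
    using True l by (intro nn_integral_cong) (auto simp: powr_minus_divide split: split_indicator)
  also have "\<dots> = ennreal (ln 1 - ln l)"
    by (rule nn_integral_FTC_Icc) (use l in \<open>auto intro!: derivative_eq_intros\<close>)
  also have "\<dots> \<le> ennreal (2 * (psi d l)\<^sup>2)"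
    unfolding L(2) psi using L(1) by (intro ennreal_leI) simp
  finally show ?thesis
    using that[of l] l L psi by (simp add: mult_le_cancel_left1 flip: L_def)
next
  case False
  with d have d: "3 \<le> d" by simp
  define a where "a = 1 - 2 / real d"
  have a: "1 / 3 \<le> a" "a < 1"
    using d by (auto simp: a_def field_simps)
  have psi: "(psi d l)\<^sup>2 = l powr (- a)"
  proof -
    have "(psi d l)\<^sup>2 = l powr (1 / real d - 1 / 2) * l powr (1 / real d - 1 / 2)"
      using False by (simp add: psi_def power2_eq_square)
    also have "\<dots> = l powr (- a)"
      unfolding powr_add[symmetric] by (simp add: a_def)
    finally show ?thesis .
  qed
  define \<delta> where "\<delta> = l powr (2 / real d)"
  have \<delta>: "0 < \<delta>" "\<delta> \<le> 1"
    using l by (auto simp: \<delta>_def intro: powr_le1)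
  have 1: "\<delta> \<le> l * (psi d l)\<^sup>2"
  proof -
    have "\<delta> = l powr 1 * l powr (- a)"
      unfolding \<delta>_def powr_add[symmetric] by (simp add: a_def)
    then show ?thesis using l psi by simp
  qed
  define e where "e = real d / 2 - 1"
  have e: "1 / 2 \<le> e" "- real d / 2 = - e - 1"
    using d by (auto simp: e_def)
  have \<delta>_e: "\<delta> powr (- e) = (psi d l)\<^sup>2"
  proof -
    have "2 / real d * - e = - a"
      using d by (simp add: a_def e_def field_simps)
    then show ?thesis
      unfolding psi \<delta>_def powr_powr by simp
  qed
  have 2: "(\<integral>\<^sup>+u. ennreal (u powr (- real d / 2)) * indicator {\<delta>..1} u \<partial>lborel) \<le> ennreal (2 * (psi d l)\<^sup>2)"
  proof -
    have "(\<integral>\<^sup>+u. ennreal (u powr (- real d / 2)) * indicator {\<delta>..1} u \<partial>lborel)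
        = ennreal (- (1 powr (- e)) / e - (- (\<delta> powr (- e)) / e))"
    proof (rule nn_integral_FTC_Icc[where F="\<lambda>u. - (u powr (- e)) / e"])
      fix u :: real assume "u \<in> {\<delta>..1}"
      then have "0 < u" using \<delta> by simp
      then have "DERIV (\<lambda>u. - (u powr (- e)) / e) u :> - ((- e) * u powr (- e - 1)) / e"
        by (intro DERIV_cdivide DERIV_minus has_real_derivative_powr)
      moreover have "- ((- e) * u powr (- e - 1)) / e = u powr (- real d / 2)"
        unfolding e(2) using e(1) by simp
      ultimately show "DERIV (\<lambda>u. - (u powr (- e)) / e) u :> u powr (- real d / 2)"
        by (rule DERIV_cong)
    qed (use \<delta> in auto)
    also have "\<dots> \<le> ennreal (2 * (psi d l)\<^sup>2)"
    proof (rule ennreal_leI)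
      have "- (1 powr (- e)) / e - (- (\<delta> powr (- e)) / e) \<le> (psi d l)\<^sup>2 / e"
        unfolding \<delta>_e using e(1) by (simp add: field_simps)
      also have "\<dots> \<le> (psi d l)\<^sup>2 / (1 / 2)"
        using e(1) by (intro divide_left_mono) auto
      finally show "- (1 powr (- e)) / e - (- (\<delta> powr (- e)) / e) \<le> 2 * (psi d l)\<^sup>2"
        by simp
    qed
    finally show ?thesis .
  qed
  have 3: "ln (1 / l) \<le> 3 * (psi d l)\<^sup>2"
  proof -
    have "ln (1 / l) \<le> (1 / l) powr a / a"
      by (rule ln_powr_bound) (use l a in auto)
    also have "\<dots> \<le> (1 / l) powr a / (1 / 3)"
      using a by (intro divide_left_mono) auto
    also have "(1 / l) powr a = (psi d l)\<^sup>2"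
      unfolding psi using l by (simp add: powr_minus powr_divide field_simps)
    finally show ?thesis by simp
  qed
  have 4: "1 \<le> (psi d l)\<^sup>2"
    unfolding psi using l a by (simp add: powr_minus one_le_inverse_iff powr_le1)
  show ?thesis
    by (rule that[OF \<delta>(1) 1 2 3 4])
qed

lemma nn_integral_exp_tail:
  fixes \<kappa> \<tau> :: real
  assumes "0 < \<kappa>"
  shows "(\<integral>\<^sup>+u. ennreal (exp (- \<kappa> * u)) * indicator {\<tau>..} u \<partial>lborel) = ennreal (exp (- \<kappa> * \<tau>) / \<kappa>)"
proof -
  have "(\<integral>\<^sup>+u. ennreal (exp (- \<kappa> * u)) * indicator {\<tau>..} u \<partial>lborel) = ennreal (0 - (- exp (- \<kappa> * \<tau>) / \<kappa>))"
  proof (rule nn_integral_FTC_atLeast)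
    show "DERIV (\<lambda>u. - exp (- \<kappa> * u) / \<kappa>) u :> exp (- \<kappa> * u)" for u
      using assms by (auto intro!: derivative_eq_intros)
    have "filterlim (\<lambda>u. - \<kappa> * u) at_bot at_top"
      using assms by (intro filterlim_tendsto_neg_mult_at_bot[OF tendsto_const _ filterlim_ident]) simp
    from tendsto_divide[OF tendsto_minus[OF filterlim_compose[OF exp_at_bot this]] tendsto_const[of \<kappa>]]
    show "((\<lambda>u. - exp (- \<kappa> * u) / \<kappa>) \<longlongrightarrow> 0) at_top"
      using assms by simp
  qed auto
  then show ?thesis by simp
qed

text \<open>
  The integral of a covariance envelope that is constant up to \<open>\<delta>\<close>, a power plus a constant up to \<open>1\<close>,
  constant up to \<open>\<tau>\<close> and exponential afterwards. Writing it as a sum of overlapping pieces, rather than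
  by cases, lets each piece be integrated separately; it only increases the envelope.
\<close>

lemma nn_integral_envelope_le:
  fixes A1 A2 A3 A4 A5 \<delta> \<tau> \<kappa> e J :: real
  assumes A: "0 \<le> A1" "0 \<le> A2" "0 \<le> A3" "0 \<le> A4" "0 \<le> A5"
    and \<delta>: "0 < \<delta>" and \<tau>: "1 \<le> \<tau>" and \<kappa>: "0 < \<kappa>" and J: "0 \<le> J"
      "(\<integral>\<^sup>+u. ennreal (u powr e) * indicator {\<delta>..1} u \<partial>lborel) \<le> ennreal J"
  defines "D \<equiv> \<lambda>u. A1 * indicator {0..\<delta>} u + A2 * (u powr e * indicator {\<delta>..1} u) + A3 * indicator {0..1} u
    + A4 * indicator {1..\<tau>} u + A5 * (exp (- \<kappa> * u) * indicator {\<tau>..} u)"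
  shows "(\<integral>\<^sup>+u. ennreal (D u) \<partial>lborel)
    \<le> ennreal (A1 * \<delta> + A2 * J + A3 + A4 * (\<tau> - 1) + A5 * (exp (- \<kappa> * \<tau>) / \<kappa>))"
proof -
  have "ennreal (D u) = ennreal A1 * indicator {0..\<delta>} u + ennreal A2 * (ennreal (u powr e) * indicator {\<delta>..1} u)
      + ennreal A3 * indicator {0..1} u + ennreal A4 * indicator {1..\<tau>} u
      + ennreal A5 * (ennreal (exp (- \<kappa> * u)) * indicator {\<tau>..} u)" for u
    unfolding D_def using A by (simp add: ennreal_plus ennreal_mult ennreal_indicator)
  then have "(\<integral>\<^sup>+u. ennreal (D u) \<partial>lborel) =
      ennreal A1 * ennreal \<delta> + ennreal A2 * (\<integral>\<^sup>+u. ennreal (u powr e) * indicator {\<delta>..1} u \<partial>lborel)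
      + ennreal A3 + ennreal A4 * ennreal (\<tau> - 1)
      + ennreal A5 * ennreal (exp (- \<kappa> * \<tau>) / \<kappa>)"
    using \<delta> \<tau> by (simp add: nn_integral_add nn_integral_cmult nn_integral_cmult_indicator nn_integral_exp_tail[OF \<kappa>, simplified])
  also have "\<dots> \<le> ennreal A1 * ennreal \<delta> + ennreal A2 * ennreal J
      + ennreal A3 + ennreal A4 * ennreal (\<tau> - 1) + ennreal A5 * ennreal (exp (- \<kappa> * \<tau>) / \<kappa>)"
    by (intro add_mono mult_left_mono J order_refl) simp_all
  also have "\<dots> = ennreal (A1 * \<delta> + A2 * J + A3 + A4 * (\<tau> - 1) + A5 * (exp (- \<kappa> * \<tau>) / \<kappa>))"
  proof -
    have "0 \<le> exp (- \<kappa> * \<tau>) / \<kappa>" using \<kappa> by simp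
    then show ?thesis
      using A \<delta> \<tau> J(1) by (simp add: ennreal_plus ennreal_mult del: times_divide_eq_right)
  qed
  finally show ?thesis .
qed

section \<open>The variance bound\<close>

lemma abs_le_sup_norm: "bounded (range f) \<Longrightarrow> \<bar>f x\<bar> \<le> sup_norm f"
  unfolding sup_norm_def
  by (rule cSUP_upper) (auto simp: bounded_iff bdd_above_def)

text \<open>
  The mixing bound carries no power of the small volume \<open>l\<close>. It is used only from the time
  \<open>\<tau> = 1 + (2 / \<kappa>) ln (1 / l)\<close> on, where \<open>exp (- \<kappa> \<tau>) \<le> l\<^sup>2\<close>; the price is a factor \<open>\<tau> - 1\<close>
  on the intermediate range, which is of order \<open>ln (1 / l)\<close> and hence of order \<open>\<Psi> = (psi d l)\<^sup>2\<close>.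
\<close>

lemma time_scales_sum_le:
  fixes b R l c2 c \<kappa> \<delta> \<Psi> L :: real
  assumes pos: "0 < R" "0 < l" "0 < c2" "0 < c" "0 < \<kappa>"
    and \<delta>: "\<delta> \<le> l * \<Psi>" and \<Psi>: "1 \<le> \<Psi>" and L: "L \<le> 3 * \<Psi>" "exp (- L) = l"
  defines "\<tau> \<equiv> 1 + 2 / \<kappa> * L"
  shows "2 * b\<^sup>2 * R * l * \<delta> + b\<^sup>2 * R * l\<^sup>2 * c2 * (2 * \<Psi>) + b\<^sup>2 * R\<^sup>2 * l\<^sup>2
      + b\<^sup>2 * R * l\<^sup>2 * (c2 + R) * (\<tau> - 1) + 2 * b\<^sup>2 * c * (exp (- \<kappa> * \<tau>) / \<kappa>)
    \<le> b\<^sup>2 * R * l\<^sup>2 * \<Psi> * (2 + 2 * c2 + R + 6 * (c2 + R) / \<kappa> + 2 * c / (\<kappa> * R))"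
proof -
  have "2 * b\<^sup>2 * R * l * \<delta> \<le> 2 * b\<^sup>2 * R * l * (l * \<Psi>)"
    using \<delta> pos by (intro mult_left_mono) auto
  moreover have "b\<^sup>2 * R\<^sup>2 * l\<^sup>2 * 1 \<le> b\<^sup>2 * R\<^sup>2 * l\<^sup>2 * \<Psi>"
    using \<Psi> by (intro mult_left_mono) auto
  moreover have "b\<^sup>2 * R * l\<^sup>2 * (c2 + R) * (\<tau> - 1) \<le> b\<^sup>2 * R * l\<^sup>2 * (c2 + R) * (2 / \<kappa> * (3 * \<Psi>))"
    unfolding \<tau>_def using L pos by (intro mult_left_mono) (auto intro!: divide_right_mono)
  moreover have "2 * b\<^sup>2 * c * (exp (- \<kappa> * \<tau>) / \<kappa>) \<le> 2 * b\<^sup>2 * c * ((l\<^sup>2 * \<Psi>) / \<kappa>)"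
  proof (intro mult_left_mono divide_right_mono)
    have "exp (- \<kappa> * \<tau>) = exp (- \<kappa>) * (exp (- L))\<^sup>2"
      using pos by (simp add: \<tau>_def algebra_simps flip: exp_add exp_double)
    also have "\<dots> \<le> 1 * l\<^sup>2"
      unfolding L using pos by (intro mult_right_mono) auto
    also have "\<dots> \<le> l\<^sup>2 * \<Psi>"
      using \<Psi> by (simp add: mult_le_cancel_left1)
    finally show "exp (- \<kappa> * \<tau>) \<le> l\<^sup>2 * \<Psi>" .
  qed (use pos in auto)
  moreover have "2 * b\<^sup>2 * R * l * (l * \<Psi>) + b\<^sup>2 * R * l\<^sup>2 * c2 * (2 * \<Psi>) + b\<^sup>2 * R\<^sup>2 * l\<^sup>2 * \<Psi>
      + b\<^sup>2 * R * l\<^sup>2 * (c2 + R) * (2 / \<kappa> * (3 * \<Psi>)) + 2 * b\<^sup>2 * c * ((l\<^sup>2 * \<Psi>) / \<kappa>)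
    = b\<^sup>2 * R * l\<^sup>2 * \<Psi> * (2 + 2 * c2 + R + 6 * (c2 + R) / \<kappa> + 2 * c / (\<kappa> * R))"
    using pos by (simp add: field_simps power2_eq_square)
  ultimately show ?thesis by linarith
qed

text \<open>
  The envelope of the covariance uses, in order of increasing lag: the trivial bound up to \<open>\<delta>\<close>, the
  density bound up to \<open>1\<close>, the density bound at time \<open>1\<close> transported to later times by
  Chapman--Kolmogorov up to \<open>\<tau>\<close>, and mixing beyond \<open>\<tau>\<close>.
\<close>

lemma (in stationary_right_process) variance_le_of_kernel_bounds:
  fixes f :: "'a \<Rightarrow> real" and d :: nat
  assumes d: "2 \<le> d" and T: "0 \<le> T"
    and f: "f \<in> borel_measurable borel" and S: "S \<in> sets borel"
    and bound: "\<And>x. \<bar>f x\<bar> \<le> b * indicator S x"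
    and pos: "0 < R" "0 < c2" "0 < c" "0 < \<kappa>"
    and l: "0 < l" "l < 1" and \<mu>S: "measure \<mu> S \<le> R * l"
    and short: "\<And>x u. 0 < u \<Longrightarrow> u \<le> 1 \<Longrightarrow>
      emeasure (transition X Pr u x) S \<le> ennreal (c2 * u powr (- real d / 2) * l)"
    and mix: "\<And>u. 0 \<le> u \<Longrightarrow>
      (\<integral>\<^sup>+x. ennreal (tv_norm_diff (transition X Pr u x) \<mu>) \<partial>\<mu>) \<le> ennreal (c * exp (- \<kappa> * u))"
  shows "variance (\<lambda>\<omega>. LBINT t:{0..T}. f (X t \<omega>)) \<le>
    2 * T * (b\<^sup>2 * R * l\<^sup>2 * (psi d l)\<^sup>2 * (2 + 2 * c2 + R + 6 * (c2 + R) / \<kappa> + 2 * c / (\<kappa> * R)))"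
proof -
  define m where "m = (\<integral>x. f x \<partial>\<mu>)"
  let ?K = "\<lambda>s u. \<bar>expectation (\<lambda>\<omega>. (f (X s \<omega>) - m) * (f (X (s + u) \<omega>) - m))\<bar>"
  have fb: "\<bar>f x\<bar> \<le> \<bar>b\<bar>" for x
    using bound[of x] by (auto split: split_indicator_asm)
  have return: "?K s u \<le> b\<^sup>2 * (R * l) * (q + R * l)"
    if "0 \<le> s" "0 < u" "0 \<le> q" "\<And>x. emeasure (transition X Pr u x) S \<le> ennreal q" for s u q
  proof -
    have "?K s u \<le> b\<^sup>2 * measure \<mu> S * (q + measure \<mu> S)"
      unfolding m_def by (rule covariance_le_return_probability) (use that f S bound in auto)
    also have "\<dots> \<le> b\<^sup>2 * (R * l) * (q + R * l)"
      by (intro mult_mono add_mono \<mu>S) (use pos l \<open>0 \<le> q\<close> in auto)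
    finally show ?thesis .
  qed
  have trivial: "?K s u \<le> 2 * b\<^sup>2 * R * l" if "0 \<le> s" "0 < u" for s u
  proof -
    have "?K s u \<le> b\<^sup>2 * measure \<mu> S * (1 + measure \<mu> S)"
      unfolding m_def
      by (rule covariance_le_return_probability)
         (use that f S bound prob_space_transition[of u, THEN prob_space.emeasure_le_1] in auto)
    also have "\<dots> \<le> b\<^sup>2 * (R * l) * (1 + 1)"
      by (intro mult_mono add_mono \<mu>S) (use pos l in auto)
    finally show ?thesis by simp
  qed
  have long: "emeasure (transition X Pr u x) S \<le> ennreal (c2 * l)" if "1 \<le> u" for u x
  proof -
    interpret P: prob_space "transition X Pr (u - 1) x"
      using that by (intro prob_space_transition) simp
    have "emeasure (transition X Pr (u - 1 + 1) x) S =
        (\<integral>\<^sup>+y. emeasure (transition X Pr 1 y) S \<partial>transition X Pr (u - 1) x)"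
      by (rule chapman_kolmogorov) (use that S in auto)
    also have "\<dots> \<le> (\<integral>\<^sup>+y. ennreal (c2 * l) \<partial>transition X Pr (u - 1) x)"
      using short[of 1] by (intro nn_integral_mono) simp
    also have "\<dots> = ennreal (c2 * l)"
      by (simp add: P.emeasure_space_1)
    finally show ?thesis by simp
  qed
  obtain \<delta> where \<delta>: "0 < \<delta>" "\<delta> \<le> l * (psi d l)\<^sup>2"
    "(\<integral>\<^sup>+u. ennreal (u powr (- real d / 2)) * indicator {\<delta>..1} u \<partial>lborel) \<le> ennreal (2 * (psi d l)\<^sup>2)"
    and psi: "ln (1 / l) \<le> 3 * (psi d l)\<^sup>2" "1 \<le> (psi d l)\<^sup>2"
    using dimension_scale[OF d l] by blast
  define \<tau> where "\<tau> = 1 + 2 / \<kappa> * ln (1 / l)"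
  have \<tau>: "1 \<le> \<tau>"
    using l pos by (simp add: \<tau>_def)
  define D where "D u = 2 * b\<^sup>2 * R * l * indicator {0..\<delta>} u
    + b\<^sup>2 * R * l\<^sup>2 * c2 * (u powr (- real d / 2) * indicator {\<delta>..1} u)
    + b\<^sup>2 * R\<^sup>2 * l\<^sup>2 * indicator {0..1} u + b\<^sup>2 * R * l\<^sup>2 * (c2 + R) * indicator {1..\<tau>} u
    + 2 * b\<^sup>2 * c * (exp (- \<kappa> * u) * indicator {\<tau>..} u)" for u :: real
  define H where "H = 2 * b\<^sup>2 * R * l * \<delta> + b\<^sup>2 * R * l\<^sup>2 * c2 * (2 * (psi d l)\<^sup>2) + b\<^sup>2 * R\<^sup>2 * l\<^sup>2
    + b\<^sup>2 * R * l\<^sup>2 * (c2 + R) * (\<tau> - 1) + 2 * b\<^sup>2 * c * (exp (- \<kappa> * \<tau>) / \<kappa>)"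
  have D_ge:
    "2 * b\<^sup>2 * R * l * indicator {0..\<delta>} u \<le> D u"
    "b\<^sup>2 * R * l\<^sup>2 * c2 * (u powr (- real d / 2) * indicator {\<delta>..1} u) + b\<^sup>2 * R\<^sup>2 * l\<^sup>2 * indicator {0..1} u \<le> D u"
    "b\<^sup>2 * R * l\<^sup>2 * (c2 + R) * indicator {1..\<tau>} u \<le> D u"
    "2 * b\<^sup>2 * c * (exp (- \<kappa> * u) * indicator {\<tau>..} u) \<le> D u" for u
    unfolding D_def using pos l by (auto intro!: add_nonneg_nonneg mult_nonneg_nonneg)
  have K_le: "?K s u \<le> D u" if su: "0 \<le> s" "0 < u" for s u
  proof -
    consider "u \<le> \<delta>" | "\<delta> < u" "u \<le> 1" | "1 < u" "u \<le> \<tau>" | "\<tau> < u" by linarith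
    then show ?thesis
    proof cases
      case 1
      then show ?thesis using trivial[OF su] D_ge(1)[of u] su by simp
    next
      case 2
      have "?K s u \<le> b\<^sup>2 * (R * l) * (c2 * u powr (- real d / 2) * l + R * l)"
        by (rule return) (use su 2 pos l short in auto)
      also have "\<dots> = b\<^sup>2 * R * l\<^sup>2 * c2 * (u powr (- real d / 2) * indicator {\<delta>..1} u) + b\<^sup>2 * R\<^sup>2 * l\<^sup>2 * indicator {0..1} u"
        using 2 su by (simp add: power2_eq_square algebra_simps)
      also note D_ge(2)
      finally show ?thesis .
    next
      case 3
      have "?K s u \<le> b\<^sup>2 * (R * l) * (c2 * l + R * l)"
        by (rule return) (use su 3 pos l long in auto)
      also have "\<dots> = b\<^sup>2 * R * l\<^sup>2 * (c2 + R) * indicator {1..\<tau>} u"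
        using 3 by (simp add: power2_eq_square algebra_simps)
      also note D_ge(3)
      finally show ?thesis .
    next
      case 4
      have "?K s u \<le> 2 * \<bar>b\<bar>\<^sup>2 * (c * exp (- \<kappa> * u))"
        unfolding m_def by (rule covariance_le_mixing) (use su f fb mix pos in auto)
      also have "\<dots> = 2 * b\<^sup>2 * c * (exp (- \<kappa> * u) * indicator {\<tau>..} u)"
        using 4 by simp
      also note D_ge(4)
      finally show ?thesis .
    qed
  qed
  have "(\<integral>\<^sup>+u. ennreal (D u) * indicator {0<..} u \<partial>lborel) \<le> (\<integral>\<^sup>+u. ennreal (D u) \<partial>lborel)"
    by (intro nn_integral_mono) (auto split: split_indicator)
  also have "\<dots> \<le> ennreal H"
    unfolding D_def H_def by (rule nn_integral_envelope_le) (use pos l \<delta> \<tau> in auto)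
  finally have D_int: "(\<integral>\<^sup>+u. ennreal (D u) * indicator {0<..} u \<partial>lborel) \<le> ennreal H" .
  have "0 \<le> H"
    unfolding H_def using pos l \<delta>(1) \<tau> by (auto intro!: add_nonneg_nonneg mult_nonneg_nonneg)
  moreover have "D \<in> borel_measurable borel"
    unfolding D_def[abs_def] by measurable
  ultimately have "variance (\<lambda>\<omega>. LBINT t:{0..T}. f (X t \<omega>)) \<le> 2 * T * H"
    by (intro variance_time_integral_le[OF T f fb K_le _ D_int])
  also have "\<dots> \<le> 2 * T * (b\<^sup>2 * R * l\<^sup>2 * (psi d l)\<^sup>2 * (2 + 2 * c2 + R + 6 * (c2 + R) / \<kappa> + 2 * c / (\<kappa> * R)))"
    unfolding H_def \<tau>_def
    by (intro mult_left_mono time_scales_sum_le) (use pos l \<delta> psi T in \<open>auto simp: ln_div\<close>)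
  finally show ?thesis .
qed

theorem proposition2p5:
  fixes M :: "'w measure"
    and X :: "real \<Rightarrow> 'w \<Rightarrow> real ^ 'd"
    and Pr :: "real ^ 'd \<Rightarrow> 'w measure"
    and p :: "real \<Rightarrow> real ^ 'd \<Rightarrow> real ^ 'd \<Rightarrow> real"
    and \<mu> :: "(real ^ 'd) measure"
    and \<rho> :: "real ^ 'd \<Rightarrow> real"
    and c2 :: real
  assumes dim: "CARD('d) \<ge> 2"
    and process: "borel_right_process M X Pr"
    and p_measurable: "\<And>t. t > 0 \<Longrightarrow> (\<lambda>(x, y). p t x y) \<in> borel_measurable (borel \<Otimes>\<^sub>M borel)"
    and p_nonneg: "\<And>t x y. t > 0 \<Longrightarrow> p t x y \<ge> 0"
    and p_density: "\<And>t x. t > 0 \<Longrightarrow>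
      transition X Pr t x = density lborel (\<lambda>y. ennreal (p t x y))"
    and invariant: "invariant_prob (transition X Pr) \<mu>"
    and unique: "\<And>\<nu>. invariant_prob (transition X Pr) \<nu> \<Longrightarrow> \<nu> = \<mu>"
    and \<rho>_measurable: "\<rho> \<in> borel_measurable borel"
    and \<rho>_nonneg: "\<And>x. \<rho> x \<ge> 0"
    and \<rho>_bounded: "bounded (range \<rho>)"
    and \<rho>_density: "\<mu> = density lborel (\<lambda>x. ennreal (\<rho> x))"
    and c2_pos: "c2 > 0"
    and p_bound: "\<And>t x y. 0 < t \<Longrightarrow> t \<le> 1 \<Longrightarrow> p t x y \<le> c2 * t powr (- real CARD('d) / 2)"
    and mixing: "exp_beta_mixing (transition X Pr) \<mu>"
  shows "\<exists>C>0. \<forall>f :: real ^ 'd \<Rightarrow> real.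
    f \<in> borel_measurable borel \<longrightarrow> bounded (range f) \<longrightarrow>
    compact (supp f) \<longrightarrow> measure lborel (supp f) < 1 \<longrightarrow>
    (\<forall>T>0.
      prob_space.variance (\<mu> \<bind> Pr) (\<lambda>\<omega>. LBINT t:{0..T}. f (X t \<omega>))
        \<le> C * T * (sup_norm f)\<^sup>2 * sup_norm \<rho> * (measure lborel (supp f))\<^sup>2
            * (psi CARD('d) (measure lborel (supp f)))\<^sup>2)"
proof -
  interpret stationary_right_process M X Pr \<mu>
    using process invariant by (simp add: stationary_right_process_def stationary_right_process_axioms_def)
  define R where "R = sup_norm \<rho>"
  have \<rho>_le: "\<rho> x \<le> R" for x
    using abs_le_sup_norm[OF \<rho>_bounded, of x] by (simp add: R_def)
  have \<mu>_le: "emeasure \<mu> S \<le> ennreal R * emeasure lborel S" if "S \<in> sets borel" for S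
  proof -
    have "emeasure \<mu> S = (\<integral>\<^sup>+x. ennreal (\<rho> x) * indicator S x \<partial>lborel)"
      unfolding \<rho>_density using that \<rho>_measurable by (simp add: emeasure_density)
    also have "\<dots> \<le> (\<integral>\<^sup>+x. ennreal R * indicator S x \<partial>lborel)"
      by (intro nn_integral_mono mult_right_mono ennreal_leI \<rho>_le) simp
    also have "\<dots> = ennreal R * emeasure lborel S"
      using that by (simp add: nn_integral_cmult_indicator)
    finally show ?thesis .
  qed
  \<comment> \<open>The mixing bound carries no factor \<open>R\<close>, so the constant \<open>C\<close> divides by \<open>R\<close> to supply one.\<close>
  have R_pos: "0 < R"
  proof (rule ccontr)
    assume "\<not> 0 < R"
    then have "emeasure \<mu> UNIV = 0"
      using \<mu>_le[of UNIV] by (simp add: ennreal_neg)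
    then show False
      using \<mu>.emeasure_space_1 by simp
  qed
  obtain c \<kappa> where c\<kappa>: "0 < c" "0 < \<kappa>"
    and mix: "\<And>u. 0 \<le> u \<Longrightarrow>
      (\<integral>\<^sup>+x. ennreal (tv_norm_diff (transition X Pr u x) \<mu>) \<partial>\<mu>) \<le> ennreal (c * exp (- \<kappa> * u))"
    using mixing unfolding exp_beta_mixing_def by blast
  define C where "C = 2 * (2 + 2 * c2 + R + 6 * (c2 + R) / \<kappa> + 2 * c / (\<kappa> * R))"
  have "0 < C"
    unfolding C_def using R_pos c2_pos c\<kappa> by (auto intro!: add_pos_pos)
  moreover have "variance (\<lambda>\<omega>. LBINT t:{0..T}. f (X t \<omega>))
      \<le> C * T * (sup_norm f)\<^sup>2 * R * (measure lborel (supp f))\<^sup>2 * (psi CARD('d) (measure lborel (supp f)))\<^sup>2"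
    if f: "f \<in> borel_measurable borel" and fb: "bounded (range f)" and S: "compact (supp f)"
      and l1: "measure lborel (supp f) < 1" and T: "0 < T" for f :: "real ^ 'd \<Rightarrow> real" and T
  proof -
    define S l where "S = supp f" and "l = measure lborel S"
    have S_sets: "S \<in> sets borel"
      by (simp add: S_def supp_def)
    have l: "emeasure lborel S = ennreal l" "0 \<le> l" "l < 1"
      using emeasure_compact_finite[OF S] l1
      by (auto simp: l_def S_def emeasure_eq_ennreal_measure)
    have bound: "\<bar>f x\<bar> \<le> sup_norm f * indicator S x" for x
      using abs_le_sup_norm[OF fb, of x] closure_subset[of "{x. f x \<noteq> 0}"]
      by (auto simp: S_def supp_def split: split_indicator)
    have \<mu>S: "measure \<mu> S \<le> R * l"
      using \<mu>_le[OF S_sets] R_pos l by (simp add: \<mu>.emeasure_eq_measure flip: ennreal_mult)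
    show ?thesis
    proof (cases "l = 0")
      case True
      \<comment> \<open>All covariances vanish since \<open>\<mu>\<close> does not charge the support.\<close>
      have "variance (\<lambda>\<omega>. LBINT t:{0..T}. f (X t \<omega>)) \<le> 2 * T * 0"
      proof (rule variance_time_integral_le[where D="\<lambda>_. 0" and m="\<integral>x. f x \<partial>\<mu>"])
        fix s u :: real assume "0 \<le> s" "0 < u"
        moreover have "emeasure (transition X Pr u x) S \<le> ennreal 1" for x
          using prob_space.emeasure_le_1[OF prob_space_transition] \<open>0 < u\<close> by simp
        ultimately have "\<bar>expectation (\<lambda>\<omega>. (f (X s \<omega>) - (\<integral>x. f x \<partial>\<mu>)) * (f (X (s + u) \<omega>) - (\<integral>x. f x \<partial>\<mu>)))\<bar>
            \<le> (sup_norm f)\<^sup>2 * measure \<mu> S * (1 + measure \<mu> S)"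
          by (intro covariance_le_return_probability[OF _ _ f S_sets bound]) auto
        moreover have "measure \<mu> S = 0"
          using \<mu>S True measure_nonneg[of \<mu> S] by simp
        ultimately show "\<bar>expectation (\<lambda>\<omega>. (f (X s \<omega>) - (\<integral>x. f x \<partial>\<mu>)) * (f (X (s + u) \<omega>) - (\<integral>x. f x \<partial>\<mu>)))\<bar> \<le> 0"
          by simp
      qed (use T f abs_le_sup_norm[OF fb] in auto)
      then show ?thesis
        using True by (simp add: l_def S_def)
    next
      case False
      have "variance (\<lambda>\<omega>. LBINT t:{0..T}. f (X t \<omega>)) \<le>
        2 * T * ((sup_norm f)\<^sup>2 * R * l\<^sup>2 * (psi CARD('d) l)\<^sup>2 * (2 + 2 * c2 + R + 6 * (c2 + R) / \<kappa> + 2 * c / (\<kappa> * R)))"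
      proof (rule variance_le_of_kernel_bounds[OF dim _ f S_sets bound R_pos c2_pos c\<kappa> _ \<open>l < 1\<close> \<mu>S _ mix])
        fix x and u :: real assume u: "0 < u" "u \<le> 1"
        have "(\<lambda>y. p u x y) \<in> borel_measurable borel"
          using measurable_compose[OF measurable_Pair1' p_measurable[OF u(1)], of x] by simp
        then have "emeasure (transition X Pr u x) S = (\<integral>\<^sup>+y. ennreal (p u x y) * indicator S y \<partial>lborel)"
          unfolding p_density[OF u(1)] using S_sets by (simp add: emeasure_density)
        also have "\<dots> \<le> (\<integral>\<^sup>+y. ennreal (c2 * u powr (- real CARD('d) / 2)) * indicator S y \<partial>lborel)"
          by (intro nn_integral_mono mult_right_mono ennreal_leI p_bound u) simp
        also have "\<dots> = ennreal (c2 * u powr (- real CARD('d) / 2) * l)"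
          using S_sets l c2_pos by (simp add: nn_integral_cmult_indicator ennreal_mult)
        finally show "emeasure (transition X Pr u x) S \<le> ennreal (c2 * u powr (- real CARD('d) / 2) * l)" .
      qed (use T l False in auto)
      also have "\<dots> = C * T * (sup_norm f)\<^sup>2 * R * l\<^sup>2 * (psi CARD('d) l)\<^sup>2"
        by (simp add: C_def algebra_simps)
      finally show ?thesis
        by (simp add: l_def S_def)
    qed
  qed
  ultimately show ?thesis
    unfolding R_def stationary_law_def by blast
qed

end
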